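(* Let $\Pi$ be a projective plane of order $p^2$, where $p\geq 7$ is prime. There is no non-zero code word $c\in\mathrm{C}(\Pi)^\perp$ of weight at most $2p^2-2p+4$ that uses more than $2$ distinct non-zero symbols of $\mathbb{F}_p$.
   Context: $\mathrm{C}(\Pi)$ is the $\mathbb{F}_p$-span of the incidence vectors of the lines of $\Pi$, viewed as vectors in $\mathbb{F}_p^{p^4+p^2+1}$ indexed by the points of $\Pi$; $\mathrm{C}(\Pi)^\perp$ is the set of vectors $v$ with $\sum_{P\in\ell}v_P=0$ in $\mathbb{F}_p$ for every line $\ell$ of $\Pi$. The weight of a vector is its number of non-zero positions. *)

theory Defs
  imports
    "HOL-Computational_Algebra.Primes"
    "HOL-Library.Cardinality"
    "HOL-Library.Function_Algebras"
    "HOL-Library.Indicator_Function"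
begin

locale projective_plane =
  fixes points :: "'a set" and lines :: "'a set set"
  assumes finite_points: "finite points"
    and line_subset: "\<And>l. l \<in> lines \<Longrightarrow> l \<subseteq> points"
    and joining_line: "\<And>x y. \<lbrakk>x \<in> points; y \<in> points; x \<noteq> y\<rbrakk>
          \<Longrightarrow> \<exists>!l. l \<in> lines \<and> x \<in> l \<and> y \<in> l"
    and meeting_point: "\<And>l m. \<lbrakk>l \<in> lines; m \<in> lines; l \<noteq> m\<rbrakk> \<Longrightarrow> \<exists>!x. x \<in> l \<and> x \<in> m"
    and quadrangle: "\<exists>Q\<subseteq>points. card Q = 4 \<and> (\<forall>l\<in>lines. card (Q \<inter> l) \<le> 2)"

locale projective_plane_of_order = projective_plane points lines
  for points :: "'a set" and lines :: "'a set set" and n :: nat +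
  assumes card_line: "\<And>l. l \<in> lines \<Longrightarrow> card l = n + 1"

text \<open>Vectors indexed by the points are functions on the ambient type that vanish outside
  the point set.\<close>

definition point_vectors :: "'a set \<Rightarrow> ('a \<Rightarrow> 'f::field) set"
  where "point_vectors points = {v. \<forall>x. x \<notin> points \<longrightarrow> v x = 0}"

definition plane_code :: "'a set set \<Rightarrow> ('a \<Rightarrow> 'f::field) set"
  where "plane_code lines = module.span (\<lambda>a v x. a * v x) (indicator ` lines)"

definition dual_code :: "'a set \<Rightarrow> 'a set set \<Rightarrow> ('a \<Rightarrow> 'f::field) set"
  where "dual_code points lines =
    {v \<in> point_vectors points. \<forall>l\<in>lines. (\<Sum>x\<in>l. v x) = 0}"

definition weight :: "'a set \<Rightarrow> ('a \<Rightarrow> 'f::field) \<Rightarrow> nat"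
  where "weight points v = card {x \<in> points. v x \<noteq> 0}"

definition nonzero_symbols :: "'a set \<Rightarrow> ('a \<Rightarrow> 'f::field) \<Rightarrow> 'f set"
  where "nonzero_symbols points v = v ` points - {0}"

text \<open>The dual code is the orthogonal complement of the code spanned by the lines.\<close>

lemma (in projective_plane) dual_code_orthogonal:
  "dual_code points lines =
    {v \<in> point_vectors points.
      \<forall>w \<in> plane_code lines. (\<Sum>x\<in>points. v x * w x) = (0::'f::field)}"
proof -
  interpret fm: module "\<lambda>(a::'f) (v::'a \<Rightarrow> 'f) x. a * v x"
    by unfold_locales (auto simp: fun_eq_iff algebra_simps)
  have ind: "(\<Sum>x\<in>points. v x * indicator l x) = (\<Sum>x\<in>l. v x)"
    if "l \<in> lines" for v :: "'a \<Rightarrow> 'f" and l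
  proof -
    have "(\<Sum>x\<in>points. v x * indicator l x) = (\<Sum>x\<in>points \<inter> l. v x)"
      using finite_points by (simp add: indicator_def sum.inter_restrict if_distrib cong: if_cong)
    then show ?thesis using line_subset[OF that] by (simp add: Int_absorb1)
  qed
  have orth: "(\<Sum>x\<in>points. v x * w x) = 0"
    if v: "\<forall>l\<in>lines. (\<Sum>x\<in>l. v x) = 0" and w: "w \<in> fm.span (indicator ` lines)" for v w
    using w
  proof (induction rule: fm.span_induct_alt)
    case base
    show ?case by simp
  next
    case (step a u w)
    then have "(\<Sum>x\<in>points. v x * u x) = 0" using ind v by auto
    moreover have "(\<Sum>x\<in>points. v x * (a * u x + w x))
        = a * (\<Sum>x\<in>points. v x * u x) + (\<Sum>x\<in>points. v x * w x)"
      by (simp add: algebra_simps sum.distrib sum_distrib_left)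
    ultimately show ?case using step by simp
  qed
  have conv: "(\<Sum>x\<in>l. v x) = 0"
    if "\<forall>w \<in> fm.span (indicator ` lines). (\<Sum>x\<in>points. v x * w x) = 0" "l \<in> lines" for v l
    using that ind[of l v] fm.span_base[of "indicator l" "indicator ` lines"] by force
  show ?thesis
    unfolding dual_code_def plane_code_def using orth conv by blast
qed

end

theory Submission imports Defs begin

text \<open>
  Let \<open>w\<close> be the weight of a word \<open>c\<close> as in the theorem and let \<open>P\<close> have symbol \<open>a \<noteq> 0\<close>. Representing
  the quotients \<open>c(Q)/a\<close> by residues in \<open>{0..p-1}\<close>, every line through \<open>P\<close> has residue sum \<open>p k\<close> with
  \<open>k \<ge> 1\<close>. If \<open>P\<close> and \<open>P'\<close> have opposite symbols, then the numbers \<open>k - 1\<close>, summed over the lines through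
  \<open>P\<close> and over those through \<open>P'\<close>, add up to the slack \<open>e = w - (2p^2 - 2p + 2) \<le> 2\<close>. So almost all
  lines have residue sum exactly \<open>p\<close>. Counting 2-secants shows that each occurring symbol occurs
  at least \<open>2p + 1 - e\<close> times.

  On a line with residue sum \<open>p\<close> a residue \<open>p - j\<close> is accompanied by residues with sum \<open>j - 1\<close>. Comparing
  frequencies of symbols with this, all classes \<open>{x, -x}\<close> of occurring symbols have almost equal
  frequencies, and if \<open>a\<close> and \<open>j a\<close> occur with \<open>2 \<le> j < p/2\<close>, then so does \<open>(j - 1) a\<close>. With at least two
  classes the occurring symbols are therefore closed under doubling, hence under halving, and since
  \<open>-1/2\<close> is the residue \<open>(p - 1)/2\<close>, all non-zero symbols occur.

  Finally one counts ordered pairs of points with symbols \<open>x\<close> and \<open>-2x\<close>, minus those with equal symbols.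
  Since the frequencies are almost equal, there are about \<open>w\<close> of them. A line with \<open>s\<close> points in the
  support contributes nothing for \<open>s \<le> 3\<close> and at most \<open>s(s - 3)/2\<close> for \<open>s \<ge> 4\<close>, and as
  \<open>w \<le> 2p^2 - 2p + 4\<close> there are too few points on lines with \<open>s \<ge> 4\<close>.
\<close>

lemma sum_by_value:
  fixes f :: "'a \<Rightarrow> 'b" and g :: "'b \<Rightarrow> 'c::semiring_1"
  assumes "finite A" "finite (UNIV :: 'b set)"
  shows "(\<Sum>x\<in>A. g (f x)) = (\<Sum>v\<in>UNIV. of_nat (card {x \<in> A. f x = v}) * g v)"
proof -
  have "(\<Sum>v\<in>UNIV. \<Sum>x | x \<in> A \<and> f x = v. g (f x)) = (\<Sum>x\<in>A. g (f x))"
    using assms by (intro sum.group) auto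
  then show ?thesis by simp
qed

section \<open>Fields of prime order\<close>

text \<open>Translation by 1 permutes the ring, so adding 1 to every element leaves the sum of all
  elements unchanged.\<close>

lemma of_nat_card_UNIV_eq_0:
  assumes "finite (UNIV :: 'f::ring_1 set)"
  shows "of_nat CARD('f) = (0 :: 'f)"
proof -
  have "(\<Sum>x\<in>UNIV. x) = (\<Sum>x\<in>(UNIV :: 'f set). x + 1)"
    by (rule sum.reindex_bij_witness[of _ "\<lambda>x. x + 1" "\<lambda>x. x - 1"]) auto
  then show ?thesis by (simp add: sum.distrib)
qed

text \<open>Over the field with p elements this is the residue in {0..p-1}; taking the least
  representative keeps p out of the definition.\<close>

definition rep :: "'f::semiring_1 \<Rightarrow> nat"
  where "rep x = (LEAST n. of_nat n = x)"

context
  fixes p :: nat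
  assumes prime_p: "prime p" and card_field: "CARD('f::field) = p"
begin

lemma finite_field: "finite (UNIV :: 'f set)"
  using prime_p card_field by (metis card.infinite not_prime_0)

lemma CHAR_field: "CHAR('f) = p"
proof -
  have "CHAR('f) dvd p"
    using of_nat_card_UNIV_eq_0[OF finite_field] card_field by (simp add: of_nat_eq_0_iff_char_dvd)
  moreover have "CHAR('f) \<noteq> 1"
    using of_nat_eq_0_iff_char_dvd[of 1, where 'a = 'f] by auto
  ultimately show ?thesis using prime_p by (auto simp: prime_nat_iff)
qed

lemma of_nat_field_eq_0_iff: "of_nat n = (0 :: 'f) \<longleftrightarrow> p dvd n"
  by (simp add: of_nat_eq_0_iff_char_dvd CHAR_field)

lemma inj_on_of_nat_field: "inj_on (of_nat :: nat \<Rightarrow> 'f) {..<p}"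
proof (rule linorder_inj_onI')
  fix i j assume "i \<in> {..<p}" "j \<in> {..<p}" "i < j"
  then have "\<not> p dvd (j - i)" by (auto dest: dvd_imp_le)
  then show "of_nat i \<noteq> (of_nat j :: 'f)"
    using \<open>i < j\<close> of_nat_field_eq_0_iff[of "j - i"] by (simp add: of_nat_diff)
qed

lemma of_nat_image_field: "(of_nat :: nat \<Rightarrow> 'f) ` {..<p} = UNIV"
  by (rule card_subset_eq) (auto simp: finite_field card_image inj_on_of_nat_field card_field)

lemma of_nat_rep: "of_nat (rep x) = (x :: 'f)"
proof -
  obtain n where "of_nat n = x" using of_nat_image_field by (metis UNIV_I imageE)
  then show ?thesis unfolding rep_def by (rule LeastI)
qed

lemma rep_less: "rep (x :: 'f) < p"
proof -
  obtain n where "of_nat n = x" "n < p" using of_nat_image_field by (metis UNIV_I imageE lessThan_iff)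
  then show ?thesis unfolding rep_def by (metis (mono_tags, lifting) Least_le le_less_trans)
qed

lemma rep_of_nat: "n < p \<Longrightarrow> rep (of_nat n :: 'f) = n"
  using inj_on_of_nat_field of_nat_rep rep_less by (metis inj_onD lessThan_iff)

lemma rep_eq_0_iff: "rep x = 0 \<longleftrightarrow> x = (0 :: 'f)"
  using of_nat_rep[of x] rep_of_nat[of 0] prime_p by (auto simp: prime_gt_0_nat)

lemma rep_1: "rep (1 :: 'f) = 1"
  using rep_of_nat[of 1] prime_gt_1_nat[OF prime_p] by simp

lemma rep_uminus: "x \<noteq> 0 \<Longrightarrow> rep (- x :: 'f) = p - rep x"
proof -
  assume x: "x \<noteq> 0"
  have "of_nat (p - rep x) = (- x :: 'f)"
    using rep_less[of x] of_nat_field_eq_0_iff[of p] by (simp add: of_nat_diff of_nat_rep)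
  moreover have "p - rep x < p" using x rep_eq_0_iff[of x] rep_less[of x] by simp
  ultimately show ?thesis using rep_of_nat by metis
qed

lemma dvd_sum_rep: "(\<Sum>i\<in>A. f i) = (0 :: 'f) \<Longrightarrow> p dvd (\<Sum>i\<in>A. rep (f i))"
  using of_nat_field_eq_0_iff[of "\<Sum>i\<in>A. rep (f i)"] by (simp add: of_nat_rep)

lemma numeral_field_neq_0:
  assumes "p \<ge> 7"
  shows "(2 :: 'f) \<noteq> 0" "(3 :: 'f) \<noteq> 0" "(5 :: 'f) \<noteq> 0"
  using of_nat_field_eq_0_iff[of 2] of_nat_field_eq_0_iff[of 3] of_nat_field_eq_0_iff[of 5] assms
  by (auto dest: dvd_imp_le)

end

section \<open>Counting in projective planes\<close>

context projective_plane_of_order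
begin

lemma finite_line: "l \<in> lines \<Longrightarrow> finite l"
  using line_subset finite_points finite_subset by blast

lemma finite_lines: "finite lines"
  by (rule finite_subset[of _ "Pow points"]) (auto simp: finite_points dest: line_subset)

text \<open>The quadrangle has three points a, b, d other than x. The lines ab and ad are different
  and meet only in a, so x cannot lie on both.\<close>

lemma ex_line_avoiding:
  assumes "x \<in> points"
  shows "\<exists>l\<in>lines. x \<notin> l"
proof -
  obtain Q where Q: "Q \<subseteq> points" "card Q = 4" "\<And>l. l \<in> lines \<Longrightarrow> card (Q \<inter> l) \<le> 2"
    using quadrangle by blast
  have "3 \<le> card (Q - {x})"
    using Q(2) by (simp add: card_Diff_singleton_if)
  then obtain T where "T \<subseteq> Q - {x}" "card T = 3"
    by (meson obtain_subset_with_card_n)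
  then obtain a b d where abd: "a \<in> Q" "b \<in> Q" "d \<in> Q" "a \<noteq> x" "a \<noteq> b" "a \<noteq> d" "b \<noteq> d"
    by (auto simp: card_3_iff)
  obtain l where l: "l \<in> lines" "a \<in> l" "b \<in> l"
    using joining_line[of a b] abd Q(1) by blast
  obtain m where m: "m \<in> lines" "a \<in> m" "d \<in> m"
    using joining_line[of a d] abd Q(1) by blast
  have "l \<noteq> m"
  proof
    assume "l = m"
    have "card {a, b, d} \<le> card (Q \<inter> l)"
      using l m abd \<open>l = m\<close> finite_line by (intro card_mono) auto
    then show False using Q(3)[OF l(1)] abd by simp
  qed
  then have "\<not> (x \<in> l \<and> x \<in> m)"
    using meeting_point[of l m] l m abd by blast
  then show ?thesis using l m by blast
qed

text \<open>The lines through x partition the remaining points.\<close>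

lemma sum_lines_through:
  fixes g :: "'a \<Rightarrow> 'b::comm_monoid_add"
  assumes "x \<in> points"
  shows "(\<Sum>l | l \<in> lines \<and> x \<in> l. \<Sum>y\<in>l - {x}. g y) = (\<Sum>y\<in>points - {x}. g y)"
proof -
  have "\<exists>l\<in>{l \<in> lines. x \<in> l}. y \<in> l - {x}" if "y \<in> points - {x}" for y
    using ex1_implies_ex[OF joining_line[OF assms, of y]] that by auto
  then have "(\<Union>l\<in>{l \<in> lines. x \<in> l}. l - {x}) = points - {x}"
    using line_subset by auto
  moreover have "(l - {x}) \<inter> (m - {x}) = {}"
    if "l \<in> {l \<in> lines. x \<in> l}" "m \<in> {l \<in> lines. x \<in> l}" "l \<noteq> m" for l m
    using meeting_point[of l m] that by (metis (no_types, lifting) Diff_iff Int_emptyI insertI1 mem_Collect_eq)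
  then have "(\<Sum>y\<in>(\<Union>l\<in>{l \<in> lines. x \<in> l}. l - {x}). g y)
      = (\<Sum>l\<in>{l \<in> lines. x \<in> l}. \<Sum>y\<in>l - {x}. g y)"
    using finite_lines finite_line by (intro sum.UNION_disjoint) auto
  ultimately show ?thesis by simp
qed

text \<open>Projection from x onto a line m that avoids x: every line through x meets m in exactly
  one point, so there are as many such lines as points on m.\<close>

lemma card_lines_through:
  assumes "x \<in> points"
  shows "card {l \<in> lines. x \<in> l} = n + 1"
proof -
  obtain m where m: "m \<in> lines" "x \<notin> m" using ex_line_avoiding[OF assms] by blast
  have "(\<Sum>y\<in>l - {x}. if y \<in> m then 1 else 0) = (1::nat)" if l: "l \<in> lines" "x \<in> l" for l
  proof -
    obtain z where z: "z \<in> l" "z \<in> m" "\<And>y. y \<in> l \<Longrightarrow> y \<in> m \<Longrightarrow> y = z"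
      using meeting_point[OF l(1) m(1)] l m by metis
    then have "(l - {x}) \<inter> {y. y \<in> m} = {z}" using m(2) by blast
    then show ?thesis using finite_line[OF l(1)] by (simp add: sum.If_cases)
  qed
  then have "card {l \<in> lines. x \<in> l}
      = (\<Sum>l | l \<in> lines \<and> x \<in> l. \<Sum>y\<in>l - {x}. if y \<in> m then 1 else 0)"
    by simp
  also have "\<dots> = (\<Sum>y\<in>points - {x}. if y \<in> m then 1 else 0)"
    by (rule sum_lines_through[OF assms])
  also have "\<dots> = card ((points - {x}) \<inter> {y. y \<in> m})"
    using finite_points by (simp add: sum.If_cases)
  also have "(points - {x}) \<inter> {y. y \<in> m} = m" using line_subset[OF m(1)] m(2) by auto
  finally show ?thesis using card_line[OF m(1)] by simp
qed

lemma sum_lines_swap: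
  fixes g :: "'a \<Rightarrow> 'a set \<Rightarrow> 'b::comm_monoid_add"
  shows "(\<Sum>l\<in>lines. \<Sum>x\<in>l. g x l) = (\<Sum>x\<in>points. \<Sum>l | l \<in> lines \<and> x \<in> l. g x l)"
proof -
  have "(\<Sum>l\<in>lines. \<Sum>x\<in>l. g x l) = (\<Sum>l\<in>lines. \<Sum>x\<in>{x \<in> points. x \<in> l}. g x l)"
    using line_subset by (intro sum.cong) auto
  also have "\<dots> = (\<Sum>x\<in>points. \<Sum>l | l \<in> lines \<and> x \<in> l. g x l)"
    using finite_lines finite_points by (rule sum.swap_restrict)
  finally show ?thesis .
qed

lemma sum_flags:
  fixes g :: "'a \<Rightarrow> 'b::semiring_1"
  shows "(\<Sum>l\<in>lines. \<Sum>x\<in>l. g x) = of_nat (n + 1) * (\<Sum>x\<in>points. g x)"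
  by (simp add: sum_lines_swap card_lines_through sum_distrib_left)

lemma sum_collinear_pairs:
  fixes g :: "'a \<Rightarrow> 'a \<Rightarrow> 'b::comm_monoid_add"
  shows "(\<Sum>l\<in>lines. \<Sum>x\<in>l. \<Sum>y\<in>l - {x}. g x y) = (\<Sum>x\<in>points. \<Sum>y\<in>points - {x}. g x y)"
  by (simp add: sum_lines_swap sum_lines_through)

lemma sum_collinear_pairs_in:
  fixes g :: "'a \<Rightarrow> 'a \<Rightarrow> 'b::comm_monoid_add"
  assumes "S \<subseteq> points"
  shows "(\<Sum>l\<in>lines. \<Sum>x\<in>l \<inter> S. \<Sum>y\<in>l \<inter> S - {x}. g x y) = (\<Sum>x\<in>S. \<Sum>y\<in>S - {x}. g x y)"
proof -
  have *: "(\<Sum>x\<in>A. \<Sum>y\<in>A - {x}. if x \<in> S then if y \<in> S then g x y else 0 else 0)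
      = (\<Sum>x\<in>A \<inter> S. \<Sum>y\<in>A \<inter> S - {x}. g x y)" if "finite A" for A
  proof -
    have "A \<inter> S - {x} = (A - {x}) \<inter> S" for x by auto
    then have "(\<Sum>x\<in>A \<inter> S. \<Sum>y\<in>A \<inter> S - {x}. g x y)
        = (\<Sum>x\<in>A. if x \<in> S then \<Sum>y\<in>(A - {x}) \<inter> S. g x y else 0)"
      using sum.inter_restrict[OF that, of "\<lambda>x. \<Sum>y\<in>(A - {x}) \<inter> S. g x y" S] by simp
    also have "\<dots> = (\<Sum>x\<in>A. \<Sum>y\<in>A - {x}. if x \<in> S then if y \<in> S then g x y else 0 else 0)"
      using that by (intro sum.cong) (auto simp: sum.inter_restrict)
    finally show ?thesis by simp
  qed
  have "(\<Sum>l\<in>lines. \<Sum>x\<in>l \<inter> S. \<Sum>y\<in>l \<inter> S - {x}. g x y)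
      = (\<Sum>l\<in>lines. \<Sum>x\<in>l. \<Sum>y\<in>l - {x}. if x \<in> S then if y \<in> S then g x y else 0 else 0)"
    by (rule sum.cong[OF refl]) (simp add: * finite_line)
  also have "\<dots> = (\<Sum>x\<in>points. \<Sum>y\<in>points - {x}. if x \<in> S then if y \<in> S then g x y else 0 else 0)"
    by (rule sum_collinear_pairs)
  also have "\<dots> = (\<Sum>x\<in>S. \<Sum>y\<in>S - {x}. g x y)"
    using *[OF finite_points] assms by (simp add: Int_absorb1)
  finally show ?thesis .
qed

end

section \<open>Functionals on residues\<close>

text \<open>If the residue sum is \<open>p * k\<close>, fewer than 2k residues exceed p/2, and only
  these can have positive \<open>\<phi>\<close>. For k >= 2 one has 2k - 1 <= 3(k - 1), whence the
  factor 3; the case k = 1 is left to \<open>tight\<close>.\<close>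

lemma functional_le_excess:
  fixes r :: "'a \<Rightarrow> nat" and \<phi> :: "nat \<Rightarrow> int"
  assumes "finite A" and sum: "1 + (\<Sum>y\<in>A. r y) = p * k" and "k \<ge> 1" and "C \<ge> 0"
    and \<phi>: "\<And>j. \<phi> j \<le> (if p < 2 * j then C else 0)"
    and tight: "k = 1 \<Longrightarrow> (\<Sum>y\<in>A. \<phi> (r y)) \<le> 0"
  shows "(\<Sum>y\<in>A. \<phi> (r y)) \<le> 3 * C * (int k - 1)"
proof (cases "k = 1")
  case True
  then show ?thesis using tight by simp
next
  case False
  define B where "B = {y \<in> A. p < 2 * r y}"
  have "(p + 1) * card B = (\<Sum>y\<in>B. p + 1)" by simp
  also have "\<dots> \<le> (\<Sum>y\<in>B. 2 * r y)" by (rule sum_mono) (auto simp: B_def)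
  also have "\<dots> \<le> (\<Sum>y\<in>A. 2 * r y)" using \<open>finite A\<close> by (intro sum_mono2) (auto simp: B_def)
  also have "\<dots> = 2 * (\<Sum>y\<in>A. r y)" by (simp add: sum_distrib_left)
  finally have le: "(p + 1) * card B + 2 \<le> p * (2 * k)" using sum by simp
  have "card B < 2 * k"
  proof (rule ccontr)
    assume "\<not> card B < 2 * k"
    then have "p * (2 * k) \<le> (p + 1) * card B" by (intro mult_mono) auto
    then show False using le by linarith
  qed
  then have card_B: "int (card B) \<le> 3 * (int k - 1)" using False \<open>k \<ge> 1\<close> by arith
  have "(\<Sum>y\<in>A. \<phi> (r y)) \<le> (\<Sum>y\<in>A. if p < 2 * r y then C else 0)"
    by (rule sum_mono) (rule \<phi>)
  also have "\<dots> = C * int (card B)"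
    using \<open>finite A\<close> by (simp add: sum.If_cases B_def Int_def)
  also have "\<dots> \<le> C * (3 * (int k - 1))" using card_B \<open>C \<ge> 0\<close> by (rule mult_left_mono)
  finally show ?thesis by (simp add: algebra_simps)
qed

text \<open>The values are made to cancel against a frequency that is symmetric under j -> p - j:
  the weight 1 at p - j meets the weight -1 at j for 2 <= j < T. The residue p - 1 gets 0, since
  together with the residue 1 of the base point it already completes the sum p and leaves nothing to
  offset a positive weight.\<close>

definition threshold :: "nat \<Rightarrow> nat \<Rightarrow> int \<Rightarrow> nat \<Rightarrow> int"
  where "threshold p T \<kappa> j =
    (if j = p - T then \<kappa> else if p - T < j \<and> j + 2 \<le> p then 1
     else if 1 \<le> j \<and> j < T then -1 else 0)"

text \<open>A residue \<open>p - j\<close> with \<open>2 \<le> j \<le> T\<close> leaves \<open>j - 1\<close> to be filled by the other residues, which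
  are therefore all smaller than \<open>T\<close>, and at least one of them is non-zero.\<close>

lemma threshold_sum_nonpos:
  fixes r :: "'a \<Rightarrow> nat"
  assumes "finite A" and sum: "1 + (\<Sum>y\<in>A. r y) = p" and T: "2 \<le> T" "2 * T < p"
    and \<kappa>: "\<kappa> \<le> 1 \<or> \<kappa> \<le> 2 \<and> (\<forall>y\<in>A. r y \<noteq> T - 1)"
  shows "(\<Sum>y\<in>A. threshold p T \<kappa> (r y)) \<le> 0"
proof (cases "\<exists>z\<in>A. p - T \<le> r z \<and> r z + 2 \<le> p")
  case False
  then have "threshold p T \<kappa> (r y) \<le> 0" if "y \<in> A" for y
    using that T by (auto simp: threshold_def)
  then show ?thesis by (rule sum_nonpos)
next
  case True
  then obtain z where z: "z \<in> A" "p - T \<le> r z" "r z + 2 \<le> p" by blast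
  define N where "N = {y \<in> A - {z}. r y \<ge> 1}"
  have fin: "finite (A - {z})" "finite N" using \<open>finite A\<close> by (auto simp: N_def)
  have rest: "(\<Sum>y\<in>A - {z}. r y) = p - 1 - r z"
    using sum z(1) \<open>finite A\<close> by (simp add: sum.remove[of A z])
  have sumN: "(\<Sum>y\<in>N. r y) = p - 1 - r z"
    unfolding rest[symmetric] using fin by (intro sum.mono_neutral_left) (auto simp: N_def)
  have small: "r y < T" if "y \<in> A - {z}" for y
    using member_le_sum[of y "A - {z}" r] that fin rest z T by simp
  have "threshold p T \<kappa> (r y) = (if r y \<ge> 1 then -1 else 0)" if "y \<in> A - {z}" for y
    using small[OF that] T by (auto simp: threshold_def)
  then have "(\<Sum>y\<in>A - {z}. threshold p T \<kappa> (r y)) = (\<Sum>y\<in>A - {z}. if r y \<ge> 1 then -1 else 0)"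
    by simp
  also have "\<dots> = - int (card N)" using fin by (simp add: sum.If_cases N_def Int_def)
  finally have total: "(\<Sum>y\<in>A. threshold p T \<kappa> (r y)) = threshold p T \<kappa> (r z) - int (card N)"
    using \<open>finite A\<close> z(1) by (simp add: sum.remove[of A z])
  have "N \<noteq> {}" using sumN z by auto
  then have N1: "card N \<ge> 1" using fin by (simp add: Suc_leI card_gt_0_iff)
  \<comment> \<open>A single companion of the residue \<open>p - T\<close> would have to be exactly
    \<open>T - 1\<close>, which the second alternative for \<open>\<kappa>\<close> excludes.\<close>
  have N2: "card N \<ge> 2" if "r z = p - T" "\<kappa> > 1"
  proof (rule ccontr)
    assume "\<not> card N \<ge> 2"
    then have "card N = 1" using N1 by simp
    then obtain y where y: "N = {y}" by (auto simp: card_1_singleton_iff)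
    then have "r y = T - 1" using sumN that T by simp
    then show False using \<kappa> that y by (auto simp: N_def)
  qed
  have "threshold p T \<kappa> (r z) \<le> int (card N)"
    using N1 N2 \<kappa> z T by (cases "\<kappa> > 1") (auto simp: threshold_def)
  then show ?thesis using total by simp
qed

section \<open>Short dual code words\<close>

locale short_dual_word = projective_plane_of_order points lines "p\<^sup>2"
  for points :: "'a set" and lines :: "'a set set" and p :: nat +
  fixes c :: "'a \<Rightarrow> 'f::field"
  assumes prime_p: "prime p" and p_ge: "p \<ge> 7" and card_field: "CARD('f) = p"
    and line_sum: "\<And>l. l \<in> lines \<Longrightarrow> (\<Sum>x\<in>l. c x) = 0"
    and weight_le: "weight points c \<le> 2 * p\<^sup>2 - 2 * p + 4"
begin

lemmas finite_F = finite_field[OF prime_p card_field]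
  and of_nat_rep_F = of_nat_rep[OF prime_p card_field]
  and rep_less_F = rep_less[OF prime_p card_field]
  and rep_of_nat_F = rep_of_nat[OF prime_p card_field]
  and rep_0_iff_F = rep_eq_0_iff[OF prime_p card_field]
  and rep_1_F = rep_1[OF prime_p card_field]
  and rep_uminus_F = rep_uminus[OF prime_p card_field]
  and dvd_sum_rep_F = dvd_sum_rep[OF prime_p card_field]
  and of_nat_0_iff_F = of_nat_field_eq_0_iff[OF prime_p card_field]
  and numeral_F = numeral_field_neq_0[OF prime_p card_field p_ge]

section \<open>Symbol frequencies and residue sums on lines\<close>

definition freq :: "'f \<Rightarrow> int"
  where "freq x = int (card {y \<in> points. c y = x})"

lemma freq_nonneg: "freq x \<ge> 0" by (simp add: freq_def)

lemma freq_pos_iff: "freq x > 0 \<longleftrightarrow> (\<exists>y\<in>points. c y = x)"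
  using finite_points by (auto simp: freq_def card_gt_0_iff)

lemma sum_by_symbol: "(\<Sum>y\<in>points. g (c y)) = (\<Sum>x\<in>UNIV. freq x * (g x :: int))"
  unfolding freq_def using sum_by_value[OF finite_points finite_F, of g c] by simp

text \<open>For \<open>c P \<noteq> 0\<close> every summand is non-negative, so this measures how
  far the lines through P are from having residue sum exactly p.\<close>

definition excess :: "'a \<Rightarrow> int"
  where "excess P = (\<Sum>l | l \<in> lines \<and> P \<in> l. int ((\<Sum>y\<in>l. rep (c y / c P)) div p) - 1)"

text \<open>Division by \<open>c P\<close> gives P itself the residue 1, so the residue sum is a
  positive multiple of p.\<close>

lemma line_residue_sum:
  assumes "c P \<noteq> 0" "l \<in> lines" "P \<in> l"
  shows "1 + (\<Sum>y\<in>l - {P}. rep (c y / c P)) = p * ((\<Sum>y\<in>l. rep (c y / c P)) div p)"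
    and "(\<Sum>y\<in>l. rep (c y / c P)) div p \<ge> 1"
proof -
  have sum: "(\<Sum>y\<in>l. rep (c y / c P)) = 1 + (\<Sum>y\<in>l - {P}. rep (c y / c P))"
    using finite_line[OF assms(2)] assms by (simp add: sum.remove[of l P] rep_1_F)
  have "(\<Sum>y\<in>l. c y / c P) = 0"
    using line_sum[OF assms(2)] by (simp add: sum_divide_distrib[symmetric])
  then have dvd: "p dvd (\<Sum>y\<in>l. rep (c y / c P))" by (rule dvd_sum_rep_F)
  then show "1 + (\<Sum>y\<in>l - {P}. rep (c y / c P)) = p * ((\<Sum>y\<in>l. rep (c y / c P)) div p)"
    using sum by simp
  then show "(\<Sum>y\<in>l. rep (c y / c P)) div p \<ge> 1"
    by (cases "(\<Sum>y\<in>l. rep (c y / c P)) div p") auto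
qed

text \<open>Adding the residue sums of the p^2 + 1 lines through P counts every other point once and
  P, of residue 1, p^2 times too often.\<close>

lemma excess_eq:
  assumes P: "P \<in> points" "c P \<noteq> 0"
  shows "int p * (excess P + int (p\<^sup>2 + 1)) = int (p\<^sup>2) + (\<Sum>y\<in>points. int (rep (c y / c P)))"
proof -
  have "int p * (excess P + int (p\<^sup>2 + 1))
      = int p * (\<Sum>l | l \<in> lines \<and> P \<in> l. int ((\<Sum>y\<in>l. rep (c y / c P)) div p))"
    unfolding excess_def using card_lines_through[OF P(1)] by (simp add: sum_subtractf)
  also have "\<dots> = (\<Sum>l | l \<in> lines \<and> P \<in> l. int (p * ((\<Sum>y\<in>l. rep (c y / c P)) div p)))"
    by (simp add: sum_distrib_left)
  also have "\<dots> = (\<Sum>l | l \<in> lines \<and> P \<in> l. 1 + (\<Sum>y\<in>l - {P}. int (rep (c y / c P))))"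
    using line_residue_sum(1)[OF P(2), symmetric] by (intro sum.cong) auto
  also have "\<dots> = int (p\<^sup>2 + 1) + (\<Sum>y\<in>points - {P}. int (rep (c y / c P)))"
    using card_lines_through[OF P(1)] by (simp add: sum.distrib sum_lines_through[OF P(1)])
  also have "(\<Sum>y\<in>points - {P}. int (rep (c y / c P))) = (\<Sum>y\<in>points. int (rep (c y / c P))) - 1"
    using finite_points P by (simp add: sum.remove[of points P] rep_1_F)
  finally show ?thesis by simp
qed

lemma weight_eq_sum: "int (weight points c) = (\<Sum>y\<in>points. if c y \<noteq> 0 then 1 else 0)"
  using finite_points by (simp add: weight_def sum.If_cases Int_def)

text \<open>The residues of z and -z add up to p for z non-zero, so the two instances of
  \<open>excess_eq\<close> together give p for each support point. The individual excesses remain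
  unknown; only their sum is controlled.\<close>

lemma excess_opposite:
  assumes P: "P \<in> points" "c P \<noteq> 0" and R: "R \<in> points" "c R = - c P"
  shows "excess P + excess R = int (weight points c) - (2 * int p ^ 2 - 2 * int p + 2)"
proof -
  have R0: "c R \<noteq> 0" using P R by simp
  have "int (rep (c y / c P)) + int (rep (c y / c R)) = int p * (if c y \<noteq> 0 then 1 else 0)" for y
    using rep_uminus_F[of "c y / c P"] rep_less_F[of "c y / c P"] P(2) R(2) rep_0_iff_F[of 0] by auto
  then have "(\<Sum>y\<in>points. int (rep (c y / c P))) + (\<Sum>y\<in>points. int (rep (c y / c R)))
      = int p * int (weight points c)"
    by (simp add: weight_eq_sum sum_distrib_left flip: sum.distrib)
  then have "int p * (excess P + excess R + 2 * int (p\<^sup>2 + 1)) = int p * (2 * int p + int (weight points c))"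
    using excess_eq[OF P] excess_eq[OF R(1) R0] by (simp add: algebra_simps power2_eq_square)
  then have "excess P + excess R + 2 * int (p\<^sup>2 + 1) = 2 * int p + int (weight points c)"
    using p_ge by simp
  then show ?thesis by simp
qed

text \<open>Sum of \<open>functional_le_excess\<close> over the lines through P. The term
  \<open>\<phi> 1\<close> is the contribution of P itself.\<close>

lemma functional_bound:
  fixes \<phi> :: "nat \<Rightarrow> int"
  assumes P: "P \<in> points" "c P \<noteq> 0" and C: "C \<ge> 0"
    and \<phi>: "\<And>j. \<phi> j \<le> (if p < 2 * j then C else 0)"
    and tight: "\<And>A. finite A \<Longrightarrow> A \<subseteq> points \<Longrightarrow> 1 + (\<Sum>y\<in>A. rep (c y / c P)) = p
      \<Longrightarrow> (\<Sum>y\<in>A. \<phi> (rep (c y / c P))) \<le> 0"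
  shows "(\<Sum>y\<in>points. \<phi> (rep (c y / c P))) \<le> \<phi> 1 + 3 * C * excess P"
proof -
  have "(\<Sum>y\<in>l - {P}. \<phi> (rep (c y / c P))) \<le> 3 * C * (int ((\<Sum>y\<in>l. rep (c y / c P)) div p) - 1)"
    if l: "l \<in> lines" "P \<in> l" for l
  proof (rule functional_le_excess[OF _ line_residue_sum(1)[OF P(2) l] line_residue_sum(2)[OF P(2) l] C \<phi>])
    show "finite (l - {P})" using finite_line l by auto
    assume "(\<Sum>y\<in>l. rep (c y / c P)) div p = 1"
    then show "(\<Sum>y\<in>l - {P}. \<phi> (rep (c y / c P))) \<le> 0"
      using tight[of "l - {P}"] line_residue_sum(1)[OF P(2) l] finite_line[OF l(1)] line_subset[OF l(1)]
      by auto
  qed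
  then have "(\<Sum>l | l \<in> lines \<and> P \<in> l. \<Sum>y\<in>l - {P}. \<phi> (rep (c y / c P))) \<le> 3 * C * excess P"
    unfolding excess_def sum_distrib_left by (intro sum_mono) auto
  then show ?thesis
    using finite_points P by (simp add: sum_lines_through sum.remove[of points P] rep_1_F)
qed

text \<open>A line through P contains either a point with symbol \<open>- c P\<close> or at least
  two further support points. Counting support points once and those with symbol
  \<open>- c P\<close> once more, each of the p^2 + 1 lines contributes at least 2 outside
  P.\<close>

lemma freq_opposite_ge:
  assumes P: "P \<in> points" "c P \<noteq> 0"
  shows "freq (- c P) \<ge> 2 * int p ^ 2 + 3 - int (weight points c)"
proof -
  define g :: "'f \<Rightarrow> int" where "g x = (if x \<noteq> 0 then 1 else 0) + (if x = - c P then 1 else 0)" for x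
  have line: "(\<Sum>y\<in>l - {P}. g (c y)) \<ge> 2" if l: "l \<in> lines" "P \<in> l" for l
  proof -
    have fin: "finite (l - {P})" using finite_line l by auto
    have g0: "g x \<ge> 0" for x by (simp add: g_def)
    have sum: "(\<Sum>y\<in>l - {P}. c y) = - c P"
      using line_sum[OF l(1)] finite_line[OF l(1)] l(2) by (simp add: sum.remove[of l P] eq_neg_iff_add_eq_0 add.commute)
    have "\<exists>z\<in>l - {P}. c z \<noteq> 0"
    proof (rule ccontr)
      assume "\<not> ?thesis"
      then have "(\<Sum>y\<in>l - {P}. c y) = 0" by (intro sum.neutral) auto
      then show False using sum P by simp
    qed
    then obtain z where z: "z \<in> l - {P}" "c z \<noteq> 0" by blast
    show ?thesis
    proof (cases "c z = - c P")
      case True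
      then have "g (c z) = 2" using P by (simp add: g_def)
      then show ?thesis using member_le_sum[of z "l - {P}" "\<lambda>y. g (c y)"] z fin g0 by auto
    next
      case False
      have "\<exists>z'\<in>l - {P} - {z}. c z' \<noteq> 0"
      proof (rule ccontr)
        assume "\<not> ?thesis"
        then have "(\<Sum>y\<in>l - {P} - {z}. c y) = 0" by (intro sum.neutral) auto
        then show False using sum False z fin by (simp add: sum.remove[of "l - {P}" z])
      qed
      then obtain z' where z': "z' \<in> l - {P} - {z}" "c z' \<noteq> 0" by blast
      have "g (c z') \<ge> 1" "g (c z) \<ge> 1" using z z' by (auto simp: g_def)
      moreover have "(\<Sum>y\<in>l - {P} - {z}. g (c y)) \<ge> g (c z')"
        using member_le_sum[of z' "l - {P} - {z}" "\<lambda>y. g (c y)"] z' fin g0 by auto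
      ultimately show ?thesis using z fin by (simp add: sum.remove[of "l - {P}" z])
    qed
  qed
  have "2 * int (p\<^sup>2 + 1) = (\<Sum>l | l \<in> lines \<and> P \<in> l. 2)"
    using card_lines_through[OF P(1)] by simp
  also have "\<dots> \<le> (\<Sum>l | l \<in> lines \<and> P \<in> l. \<Sum>y\<in>l - {P}. g (c y))"
    using line by (intro sum_mono) auto
  also have "\<dots> = (\<Sum>y\<in>points. g (c y)) - g (c P)"
    using finite_points P by (simp add: sum_lines_through sum.remove[of points P])
  also have "g (c P) = 1" using P numeral_F(1) by (auto simp: g_def eq_neg_iff_add_eq_0 simp flip: mult_2)
  also have "(\<Sum>y\<in>points. g (c y)) = int (weight points c) + freq (- c P)"
    using finite_points by (simp add: g_def sum.distrib weight_eq_sum freq_def sum.If_cases Int_def)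
  finally show ?thesis by simp
qed

lemma weight_le_int: "int (weight points c) \<le> 2 * int p ^ 2 - 2 * int p + 4"
proof -
  have "2 * p \<le> 2 * p\<^sup>2" by (simp add: power2_eq_square)
  then have "int (2 * p\<^sup>2 - 2 * p + 4) = 2 * int p ^ 2 - 2 * int p + 4" by (simp add: of_nat_diff)
  then show ?thesis using weight_le by linarith
qed

lemma p_ge_int: "int p \<ge> 7"
  using p_ge by simp

lemma freq_uminus_ge:
  assumes "x \<noteq> 0" "freq x > 0"
  shows "freq (- x) \<ge> 2 * int p ^ 2 + 3 - int (weight points c)"
  using assms freq_opposite_ge by (auto simp: freq_pos_iff)

lemma freq_uminus_pos:
  assumes "x \<noteq> 0" "freq x > 0"
  shows "freq (- x) > 0"
  using freq_uminus_ge[OF assms] weight_le_int p_ge_int by linarith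

definition slack :: int
  where "slack = int (weight points c) - (2 * int p ^ 2 - 2 * int p + 2)"

lemma slack_le: "slack \<le> 2"
  using weight_le_int by (simp add: slack_def)

lemma freq_ge:
  assumes "x \<noteq> 0" "freq x > 0"
  shows "freq x \<ge> 2 * int p + 1 - slack"
  using freq_uminus_ge[of "- x"] freq_uminus_pos[OF assms] assms by (simp add: slack_def)

section \<open>Comparing the classes of opposite symbols\<close>

definition class_freq :: "'f \<Rightarrow> int"
  where "class_freq x = freq x + freq (- x)"

lemma class_freq_uminus: "class_freq (- x) = class_freq x"
  by (simp add: class_freq_def)

lemma sum_uminus_F: "(\<Sum>x\<in>UNIV. g (- x)) = (\<Sum>x\<in>(UNIV :: 'f set). (g x :: int))"
  by (rule sum.reindex_bij_witness[of _ uminus uminus]) auto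

lemma sum_multiples:
  fixes g :: "'f \<Rightarrow> int"
  assumes "a \<noteq> 0"
  shows "(\<Sum>x\<in>UNIV. g x) = (\<Sum>j<p. g (of_nat j * a))"
  by (rule sum.reindex_bij_witness[of _ "\<lambda>j. of_nat j * a" "\<lambda>x. rep (x / a)"])
    (use assms in \<open>auto simp: of_nat_rep_F rep_less_F rep_of_nat_F\<close>)

text \<open>By symmetry the weights 1 and -1 cancel for the residues 2 to T - 1 and their negatives;
  only the terms at p - T and at 1 survive.\<close>

lemma sum_threshold:
  fixes f :: "nat \<Rightarrow> int"
  assumes T: "2 \<le> T" "2 * T < p" and sym: "\<And>j. 1 \<le> j \<Longrightarrow> j < p \<Longrightarrow> f (p - j) = f j"
  shows "(\<Sum>j<p. f j * threshold p T \<kappa> j) = \<kappa> * f T - f 1"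
proof -
  have "(\<Sum>j<p. f j * threshold p T \<kappa> j)
      = (\<Sum>j<p. (if j = p - T then \<kappa> * f j else 0)
          + (if j \<in> {p - T<..p - 2} then f j else 0) - (if j \<in> {1..<T} then f j else 0))"
    using T by (intro sum.cong) (auto simp: threshold_def)
  also have "\<dots> = \<kappa> * f (p - T) + (\<Sum>j\<in>{p - T<..p - 2}. f j) - (\<Sum>j\<in>{1..<T}. f j)"
  proof -
    have "(\<Sum>j<p. if j \<in> B then f j else 0) = (\<Sum>j\<in>B. f j)" if "B \<subseteq> {..<p}" for B
      using sum.inter_restrict[of "{..<p}" f B] that by (simp add: Int_absorb1)
    moreover have "{p - T<..p - 2} \<subseteq> {..<p}" "{1..<T} \<subseteq> {..<p}" using T by auto
    ultimately have "(\<Sum>j<p. if j \<in> {p - T<..p - 2} then f j else 0) = (\<Sum>j\<in>{p - T<..p - 2}. f j)"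
      "(\<Sum>j<p. if j \<in> {1..<T} then f j else 0) = (\<Sum>j\<in>{1..<T}. f j)"
      by blast+
    then show ?thesis
      using T by (simp add: sum.distrib sum_subtractf)
  qed
  also have "(\<Sum>j\<in>{p - T<..p - 2}. f j) = (\<Sum>j\<in>{2..<T}. f j)"
    by (rule sum.reindex_bij_witness[of _ "\<lambda>j. p - j" "\<lambda>j. p - j"])
      (use T sym in auto)
  also have "(\<Sum>j\<in>{1..<T}. f j) = f 1 + (\<Sum>j\<in>{2..<T}. f j)"
    using T by (simp add: sum.atLeast_Suc_lessThan numeral_2_eq_2)
  also have "f (p - T) = f T" using T sym by simp
  finally show ?thesis by simp
qed

text \<open>\<open>functional_bound\<close> is applied at a point with symbol a and at one with
  symbol -a, and the results are added: the excesses become \<open>slack\<close>, and the two terms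
  \<open>\<phi> 1 = -1\<close> give the -2. The value \<open>\<kappa> = 2\<close> is available when
  the multiple \<open>T - 1\<close> of a is missing up to sign.\<close>

lemma threshold_class_bound:
  assumes a: "a \<noteq> 0" "freq a > 0" and T: "2 \<le> T" "2 * T < p"
    and \<kappa>: "\<kappa> = 1 \<or> \<kappa> = 2 \<and> freq (of_nat (T - 1) * a) = 0 \<and> freq (- (of_nat (T - 1) * a)) = 0"
  shows "\<kappa> * class_freq (of_nat T * a) \<le> class_freq a - 2 + 3 * \<kappa> * slack"
proof -
  let ?\<phi> = "threshold p T \<kappa>"
  have bound: "(\<Sum>y\<in>points. ?\<phi> (rep (c y / c P))) \<le> -1 + 3 * \<kappa> * excess P"
    if P: "P \<in> points" "c P = a \<or> c P = - a" for P
  proof -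
    have P0: "c P \<noteq> 0" using P a by auto
    have "(\<Sum>y\<in>points. ?\<phi> (rep (c y / c P))) \<le> ?\<phi> 1 + 3 * \<kappa> * excess P"
    proof (rule functional_bound[OF P(1) P0])
      show "0 \<le> \<kappa>" using \<kappa> by auto
      show "?\<phi> j \<le> (if p < 2 * j then \<kappa> else 0)" for j
        using T \<kappa> by (auto simp: threshold_def)
      fix A assume A: "finite A" "A \<subseteq> points" "1 + (\<Sum>y\<in>A. rep (c y / c P)) = p"
      have "rep (c y / c P) \<noteq> T - 1" if "\<kappa> = 2" "y \<in> A" for y
      proof
        assume "rep (c y / c P) = T - 1"
        then have "c y = of_nat (T - 1) * c P"
          using of_nat_rep_F[of "c y / c P"] P0 by (simp add: field_simps)
        then have "freq (of_nat (T - 1) * c P) > 0" using that A by (auto simp: freq_pos_iff)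
        then show False using \<kappa> that P(2) by auto
      qed
      then show "(\<Sum>y\<in>A. ?\<phi> (rep (c y / c P))) \<le> 0"
        using \<kappa> by (intro threshold_sum_nonpos[OF A(1) A(3) T]) auto
    qed
    moreover have "?\<phi> 1 = -1" using T by (auto simp: threshold_def)
    ultimately show ?thesis by simp
  qed
  obtain P where P: "P \<in> points" "c P = a" using a by (auto simp: freq_pos_iff)
  obtain R where R: "R \<in> points" "c R = - a" using freq_uminus_pos[OF a] by (auto simp: freq_pos_iff)
  have "(\<Sum>x\<in>UNIV. freq x * ?\<phi> (rep (x / a))) \<le> -1 + 3 * \<kappa> * excess P"
    using bound[of P] P sum_by_symbol[of "\<lambda>x. ?\<phi> (rep (x / a))"] by simp
  moreover have "(\<Sum>x\<in>UNIV. freq (- x) * ?\<phi> (rep (x / a))) \<le> -1 + 3 * \<kappa> * excess R"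
    using bound[of R] R sum_uminus_F[of "\<lambda>x. freq (- x) * ?\<phi> (rep (x / a))"]
      sum_by_symbol[of "\<lambda>x. ?\<phi> (rep (- x / a))"] by simp
  ultimately have "(\<Sum>x\<in>UNIV. class_freq x * ?\<phi> (rep (x / a))) \<le> -2 + 3 * \<kappa> * (excess P + excess R)"
    by (simp add: class_freq_def sum.distrib algebra_simps)
  also have "excess P + excess R = slack"
    using excess_opposite[of P R] P R a by (simp add: slack_def)
  also have "(\<Sum>x\<in>UNIV. class_freq x * ?\<phi> (rep (x / a)))
      = (\<Sum>j<p. class_freq (of_nat j * a) * ?\<phi> j)"
    using a by (simp add: sum_multiples[OF a(1)] rep_of_nat_F)
  also have "\<dots> = \<kappa> * class_freq (of_nat T * a) - class_freq (of_nat 1 * a)"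
  proof (rule sum_threshold[OF T])
    fix j assume "1 \<le> j" "j < p"
    then have "of_nat (p - j) * a = - (of_nat j * a)"
      using of_nat_0_iff_F[of p] by (simp add: of_nat_diff)
    then show "class_freq (of_nat (p - j) * a) = class_freq (of_nat j * a)"
      by (simp add: class_freq_uminus)
  qed
  finally show ?thesis by simp
qed

lemma multiple_cases:
  fixes a x :: 'f
  assumes "a \<noteq> 0" "x \<noteq> 0" "x \<noteq> a" "x \<noteq> - a"
  obtains T where "2 \<le> T" "2 * T < p" "x = of_nat T * a \<or> x = - (of_nat T * a)"
proof -
  obtain j where x: "x = of_nat j * a" and "j < p"
    using assms of_nat_rep_F[of "x / a"] rep_less_F[of "x / a"] by (metis nonzero_divide_eq_eq)
  have j: "j \<noteq> 0" "j \<noteq> 1" using x assms(2,3) by (metis mult_zero_left of_nat_0, metis mult_1 of_nat_1)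
  have "of_nat (p - j) * a = - (of_nat j * a)"
    using \<open>j < p\<close> of_nat_0_iff_F[of p] by (simp add: of_nat_diff)
  then have neg: "x = - (of_nat (p - j) * a)" using x by simp
  have "p - j \<noteq> 1" using neg assms(4) by (metis mult_1 of_nat_1)
  have "odd p" using prime_p p_ge by (auto simp: prime_odd_nat)
  then have "2 * j \<noteq> p" by auto
  show ?thesis
  proof (cases "2 * j < p")
    case True
    then show ?thesis using that[of j] x j by linarith
  next
    case False
    then show ?thesis using that[of "p - j"] neg \<open>j < p\<close> \<open>p - j \<noteq> 1\<close> \<open>2 * j \<noteq> p\<close> by linarith
  qed
qed

lemma class_freq_le:
  assumes "a \<noteq> 0" "freq a > 0" "x \<noteq> 0"
  shows "class_freq x \<le> class_freq a + 4"
proof (cases "x = a \<or> x = - a")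
  case True
  then show ?thesis by (auto simp: class_freq_uminus)
next
  case False
  then obtain T where T: "2 \<le> T" "2 * T < p" "x = of_nat T * a \<or> x = - (of_nat T * a)"
    using multiple_cases[of a x] assms by blast
  \<comment> \<open>The 4 is -2 + 3 * \<open>slack\<close> at the largest possible
    \<open>slack\<close>.\<close>
  have "class_freq (of_nat T * a) \<le> class_freq a + 4"
    using threshold_class_bound[OF assms(1,2) T(1,2), of 1] slack_le by simp
  then show ?thesis using T(3) by (auto simp: class_freq_uminus)
qed

text \<open>Write F for \<open>class_freq\<close> and b for T a. If (T - 1) a were missing,
  \<open>\<kappa> = 2\<close> would give 2 F(b) <= F(a) + 10, and with F(a) <= F(b) + 4 this yields
  F(b) <= 14. But \<open>freq_ge\<close> for b and -b forces F(b) >= 4p - 2.\<close>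

lemma freq_descent:
  assumes a: "a \<noteq> 0" "freq a > 0" and T: "2 \<le> T" "2 * T < p" and pos: "freq (of_nat T * a) > 0"
  shows "freq (of_nat (T - 1) * a) > 0"
proof (rule ccontr)
  let ?b = "of_nat T * a" and ?d = "of_nat (T - 1) * a"
  assume "\<not> freq ?d > 0"
  then have d: "freq ?d = 0" using freq_nonneg[of ?d] by simp
  have "\<not> p dvd T" "\<not> p dvd (T - 1)" using T by (auto dest: dvd_imp_le)
  then have b0: "?b \<noteq> 0" and d0: "?d \<noteq> 0" using a of_nat_0_iff_F by (metis mult_eq_0_iff)+
  have "freq (- ?d) = 0"
    using freq_uminus_pos[of "- ?d"] d d0 freq_nonneg[of "- ?d"] by fastforce
  then have "2 * class_freq ?b \<le> class_freq a - 2 + 6 * slack"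
    using threshold_class_bound[OF a T, of 2] d by simp
  moreover have "class_freq a \<le> class_freq ?b + 4"
    using class_freq_le[OF b0 pos a(1)] .
  moreover have "class_freq ?b \<ge> 2 * (2 * int p + 1 - slack)"
    using freq_ge[OF b0 pos] freq_ge[of "- ?b"] freq_uminus_pos[OF b0 pos] b0 by (simp add: class_freq_def)
  ultimately show False using slack_le p_ge_int by presburger
qed

lemma freq_smaller_multiples:
  assumes a: "a \<noteq> 0" "freq a > 0" and T: "2 * T < p" and pos: "freq (of_nat T * a) > 0"
    and i: "1 \<le> i" "i \<le> T"
  shows "freq (of_nat i * a) > 0"
  using i T pos
proof (induction T)
  case (Suc T)
  show ?case
  proof (cases "i = Suc T")
    case False
    then show ?thesis
      using Suc freq_descent[OF a, of "Suc T"] by simp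
  qed (use Suc in simp)
qed simp

end

section \<open>Pairs of symbols related by doubling\<close>

lemma sum_pairs_1:
  assumes "finite A"
  shows "(\<Sum>x\<in>A. \<Sum>y\<in>A - {x}. 1) = int (card A) * (int (card A) - 1)"
proof -
  have "int (card (A - {x})) = int (card A) - 1" if "x \<in> A" for x
    using card_Suc_Diff1[OF assms that] by linarith
  then show ?thesis by simp
qed

text \<open>Summed over the ordered pairs of support points of a line, this weight vanishes if there are
  two or three such points, while over all pairs of the support it sums to about the weight of
  the code word; the difference has to come from lines with at least four support points.\<close>

definition doubling_weight :: "'f::field \<Rightarrow> 'f \<Rightarrow> int"
  where "doubling_weight u v = of_bool (v = - 2 * u) - of_bool (v = u)"

text \<open>The left side is 2 |A| plus twice the sum of N(v) (N(-2v) - N(v)). As v -> -2v permutes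
  the field, the squares N(-2v)^2 and N(v)^2 have equal sums, which completes the square.\<close>

lemma sum_doubling_weight:
  fixes f :: "'a \<Rightarrow> 'f::field" and A :: "'a set"
  defines "N \<equiv> \<lambda>v. int (card {x \<in> A. f x = v})"
  assumes fin: "finite A" "finite (UNIV :: 'f set)" and nz: "\<And>x. x \<in> A \<Longrightarrow> f x \<noteq> 0"
    and char: "(2 :: 'f) \<noteq> 0" "(3 :: 'f) \<noteq> 0"
  shows "2 * (\<Sum>x\<in>A. \<Sum>y\<in>A - {x}. doubling_weight (f x) (f y))
    = 2 * int (card A) - (\<Sum>v\<in>UNIV. (N v - N (- 2 * v))\<^sup>2)"
proof -
  have "(\<Sum>y\<in>A - {x}. doubling_weight (f x) (f y)) = N (- 2 * f x) - N (f x) + 1"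
    if x: "x \<in> A" for x
  proof -
    have "f x \<noteq> - 2 * f x"
    proof
      assume "f x = - 2 * f x"
      then have "3 * f x = 0" by algebra
      then show False using nz[OF x] char by simp
    qed
    then have "doubling_weight (f x) (f x) = -1" by (simp add: doubling_weight_def)
    moreover have "(\<Sum>y\<in>A. doubling_weight (f x) (f y)) = N (- 2 * f x) - N (f x)"
      using fin by (simp add: doubling_weight_def sum_subtractf N_def Int_def)
    ultimately show ?thesis using fin x by (simp add: sum.remove[of A x])
  qed
  then have "(\<Sum>x\<in>A. \<Sum>y\<in>A - {x}. doubling_weight (f x) (f y))
      = (\<Sum>x\<in>A. N (- 2 * f x) - N (f x)) + int (card A)"
    by (simp add: sum.distrib)
  also have "(\<Sum>x\<in>A. N (- 2 * f x) - N (f x)) = (\<Sum>v\<in>UNIV. N v * (N (- 2 * v) - N v))"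
    using sum_by_value[OF fin, of "\<lambda>v. N (- 2 * v) - N v" f] by (simp add: N_def)
  finally have 1: "2 * (\<Sum>x\<in>A. \<Sum>y\<in>A - {x}. doubling_weight (f x) (f y))
      = 2 * int (card A) + 2 * (\<Sum>v\<in>UNIV. N v * (N (- 2 * v) - N v))"
    by simp
  have "(\<Sum>v\<in>UNIV. (N (- 2 * v))\<^sup>2) = (\<Sum>v\<in>UNIV. (N v)\<^sup>2)"
    using char(1) by (intro sum.reindex_bij_witness[of _ "\<lambda>v. - v / 2" "\<lambda>v. - 2 * v"]) auto
  then have "(\<Sum>v\<in>UNIV. (N v - N (- 2 * v))\<^sup>2) = - 2 * (\<Sum>v\<in>UNIV. N v * (N (- 2 * v) - N v))"
    by (simp add: power2_diff sum.distrib sum_subtractf algebra_simps sum_distrib_left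
        power2_eq_square sum_negf)
  then show ?thesis using 1 by simp
qed

lemma sum_opposite_pairs:
  fixes f :: "'a \<Rightarrow> 'f::field" and A :: "'a set"
  defines "N \<equiv> \<lambda>v. int (card {x \<in> A. f x = v})"
  assumes fin: "finite A" "finite (UNIV :: 'f set)" and nz: "\<And>x. x \<in> A \<Longrightarrow> f x \<noteq> 0"
    and char: "(2 :: 'f) \<noteq> 0"
  shows "(\<Sum>x\<in>A. \<Sum>y\<in>A - {x}. of_bool (f y = - f x)) = (\<Sum>v\<in>UNIV. N v * N (- v))"
proof -
  have "(\<Sum>y\<in>A - {x}. of_bool (f y = - f x)) = N (- f x)" if x: "x \<in> A" for x
  proof -
    have "f x \<noteq> - f x"
      using nz[OF x] char by (metis add_self_div_2 eq_neg_iff_add_eq_0 mult_2 mult_eq_0_iff)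
    then have "{y \<in> A - {x}. f y = - f x} = {y \<in> A. f y = - f x}" by auto
    then show ?thesis using fin by (simp add: N_def Int_def)
  qed
  then show ?thesis using sum_by_value[OF fin, of "\<lambda>v. N (- v)" f] by (simp add: N_def)
qed

section \<open>The line bound, via the graph joining each symbol u to -2u\<close>

definition linked :: "'f::field \<Rightarrow> 'f \<Rightarrow> bool"
  where "linked u v \<longleftrightarrow> v = - 2 * u \<or> u = - 2 * v"

context
  assumes char: "(2 :: 'f::field) \<noteq> 0" "(3 :: 'f) \<noteq> 0" "(5 :: 'f) \<noteq> 0"
begin

lemma linked_commute: "linked u v \<longleftrightarrow> linked v (u :: 'f)"
  by (auto simp: linked_def)

lemma doubling_weight_sym:
  assumes "(u :: 'f) \<noteq> 0"
  shows "doubling_weight u v + doubling_weight v u = of_bool (linked u v) - 2 * of_bool (u = v)"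
proof -
  have "\<not> (v = - 2 * u \<and> u = - 2 * v)"
  proof
    assume "v = - 2 * u \<and> u = - 2 * v"
    then have "3 * u = 0" by algebra
    then show False using assms char by simp
  qed
  then show ?thesis by (auto simp: doubling_weight_def linked_def of_bool_def)
qed

text \<open>Going round a triangle multiplies a by -8, -2, -1/2 or -1/8. None of these is 1, because
  9 and 3 are non-zero; 18 a = 0 is a common consequence of all cases.\<close>

lemma linked_triangle:
  assumes "(a :: 'f) \<noteq> 0" "linked a b" "linked b d"
  shows "\<not> linked a d"
proof
  assume "linked a d"
  with assms(2,3) have "2 * (3 * (3 * a)) = 0"
    unfolding linked_def by (elim disjE; algebra)
  then show False using assms(1) char mult_eq_0_iff by metis
qed

lemma linked_unique:
  assumes "linked (x :: 'f) a" "linked x b" "linked x d"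
  shows "a = b \<or> a = d \<or> b = d"
proof -
  have "a = - 2 * x \<or> a = - x / 2" "b = - 2 * x \<or> b = - x / 2" "d = - 2 * x \<or> d = - x / 2"
    using assms char by (auto simp: linked_def field_simps)
  then show ?thesis by auto
qed

text \<open>A path that does not turn back is a geometric progression with ratio -2, read from one
  of its ends. Its sum is 1 - 2 + 4 - 8 = -5 times the first term.\<close>

lemma linked_path:
  assumes "(a :: 'f) \<noteq> 0" "linked a b" "linked b d" "linked d e" "a + b + d + e = 0"
  shows "a = d \<or> b = e"
proof (rule ccontr)
  assume neq: "\<not> (a = d \<or> b = e)"
  have cancel: "u = v" if "- 2 * u = - 2 * v" for u v :: 'f
    using that char by simp
  have "(b = - 2 * a \<and> d = - 2 * b \<and> e = - 2 * d) \<or> (a = - 2 * b \<and> b = - 2 * d \<and> d = - 2 * e)"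
    using assms(2-4) neq cancel unfolding linked_def by metis
  then have "5 * a = 0 \<or> 5 * e = 0 \<and> a = - 8 * e"
    using assms(5) by (elim disjE conjE; algebra)
  then show False using assms(1) char by auto
qed

text \<open>If two of the symbols are linked, the zero sum makes the third equal to one of them. So
  any link forces an equality, worth 2, and there are at most two links.\<close>

lemma doubling_weight_triple:
  assumes nz: "(a :: 'f) \<noteq> 0" "b \<noteq> 0" "d \<noteq> 0" and sum: "a + b + d = 0"
  shows "of_bool (linked a b) + of_bool (linked a d) + of_bool (linked b d)
    \<le> (2 * (of_bool (a = b) + of_bool (a = d) + of_bool (b = d)) :: int)"
proof -
  have *: "w = u \<or> w = v" if "linked u v" "u + v + w = 0" for u v w :: 'f
    using that unfolding linked_def by (elim disjE; algebra)
  have "linked a b \<Longrightarrow> d = a \<or> d = b" "linked a d \<Longrightarrow> b = a \<or> b = d" "linked b d \<Longrightarrow> a = b \<or> a = d"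
    using *[of a b d] *[of a d b] *[of b d a] sum by (auto simp: algebra_simps)
  moreover have "\<not> (linked a b \<and> linked a d \<and> linked b d)"
    using linked_triangle[of a b d] nz by blast
  ultimately show ?thesis by (auto simp: of_bool_def)
qed

text \<open>If two symbols coincide, the right side is at least 4, and a triangle-free graph on four
  vertices has at most 4 edges. If all are distinct, at most 2 edges are possible, since three edges
  contain a triangle or form a star or a path.\<close>

lemma doubling_weight_quadruple:
  assumes nz: "(a :: 'f) \<noteq> 0" "b \<noteq> 0" "d \<noteq> 0" "e \<noteq> 0" and sum: "a + b + d + e = 0"
  shows "of_bool (linked a b) + of_bool (linked a d) + of_bool (linked a e)
      + of_bool (linked b d) + of_bool (linked b e) + of_bool (linked d e)
    \<le> (2 * (of_bool (a = b) + of_bool (a = d) + of_bool (a = e)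
      + of_bool (b = d) + of_bool (b = e) + of_bool (d = e)) + 2 :: int)"
proof -
  have tri: "\<not> (linked a b \<and> linked a d \<and> linked b d)" "\<not> (linked a b \<and> linked a e \<and> linked b e)"
    "\<not> (linked a d \<and> linked a e \<and> linked d e)" "\<not> (linked b d \<and> linked b e \<and> linked d e)"
    using linked_triangle nz by blast+
  show ?thesis
  proof (cases "a = b \<or> a = d \<or> a = e \<or> b = d \<or> b = e \<or> d = e")
    case True
    then have "of_bool (a = b) + of_bool (a = d) + of_bool (a = e)
      + of_bool (b = d) + of_bool (b = e) + of_bool (d = e) \<ge> (1 :: int)"
      by (auto simp: of_bool_def)
    moreover have "of_bool (linked a b) + of_bool (linked a d) + of_bool (linked a e)
      + of_bool (linked b d) + of_bool (linked b e) + of_bool (linked d e) \<le> (4 :: int)"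
      using tri by (auto simp: of_bool_def)
    ultimately show ?thesis by presburger
  next
    case False
    have star: "\<not> (linked a b \<and> linked a d \<and> linked a e)"
      "\<not> (linked a b \<and> linked b d \<and> linked b e)"
      "\<not> (linked a d \<and> linked b d \<and> linked d e)"
      "\<not> (linked a e \<and> linked b e \<and> linked d e)"
      using False linked_unique[of a b d e] linked_unique[of b a d e]
        linked_unique[of d a b e] linked_unique[of e a b d]
      by (simp_all add: linked_commute) blast+
    \<comment> \<open>These are the twelve paths through all four vertices.\<close>
    have path: "\<not> (linked a b \<and> linked b d \<and> linked d e)"
      "\<not> (linked a b \<and> linked b e \<and> linked d e)"
      "\<not> (linked a d \<and> linked b d \<and> linked b e)"
      "\<not> (linked a d \<and> linked d e \<and> linked b e)"
      "\<not> (linked a e \<and> linked b e \<and> linked b d)"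
      "\<not> (linked a e \<and> linked d e \<and> linked b d)"
      "\<not> (linked a b \<and> linked a d \<and> linked d e)"
      "\<not> (linked a b \<and> linked a e \<and> linked d e)"
      "\<not> (linked b d \<and> linked a d \<and> linked a e)"
      "\<not> (linked b e \<and> linked a e \<and> linked a d)"
      "\<not> (linked a d \<and> linked a b \<and> linked b e)"
      "\<not> (linked b d \<and> linked a b \<and> linked a e)"
      using False nz sum
        linked_path[of a b d e] linked_path[of a b e d] linked_path[of a d b e]
        linked_path[of a d e b] linked_path[of a e b d] linked_path[of a e d b]
        linked_path[of b a d e] linked_path[of b a e d] linked_path[of b d a e]
        linked_path[of b e a d] linked_path[of d a b e] linked_path[of d b a e]
      by (simp_all add: linked_commute ac_simps) blast+
    show ?thesis
      using tri star path
      by (cases "linked a b"; cases "linked a d"; cases "linked a e"; cases "linked b d";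
          cases "linked b e"; cases "linked d e"; simp)
  qed
qed

text \<open>Let s be the number of points. For s = 2 the negative s(s - 3) is made up for by the two
  opposite pairs; for s = 3 and s = 4 the pair sum is at most 0 and 2. For s >= 5 it is at most s by
  \<open>sum_doubling_weight\<close>, and 2s <= s(s - 3).\<close>

lemma doubling_weight_line:
  fixes f :: "'a \<Rightarrow> 'f"
  assumes fin: "finite A" "finite (UNIV :: 'f set)" and nz: "\<And>x. x \<in> A \<Longrightarrow> f x \<noteq> 0"
    and sum: "(\<Sum>x\<in>A. f x) = 0"
  shows "2 * (\<Sum>x\<in>A. \<Sum>y\<in>A - {x}. doubling_weight (f x) (f y))
    \<le> int (card A) * (int (card A) - 3) + (\<Sum>x\<in>A. \<Sum>y\<in>A - {x}. of_bool (f y = - f x))"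
    (is "2 * ?D \<le> ?s * (?s - 3) + ?O")
proof -
  have O: "?O \<ge> 0" by (intro sum_nonneg) auto
  consider "card A = 0" | "card A = 1" | "card A = 2" | "card A = 3" | "card A = 4" | "card A \<ge> 5"
    by linarith
  then show ?thesis
  proof cases
    case 1
    then show ?thesis using fin by simp
  next
    case 2
    then obtain x where "A = {x}" by (auto simp: card_1_singleton_iff)
    then show ?thesis using nz sum by simp
  next
    case 3
    then obtain x y where A: "A = {x, y}" "x \<noteq> y" by (auto simp: card_2_iff)
    have D: "?D = doubling_weight (f x) (f y) + doubling_weight (f y) (f x)"
      using A by (simp add: insert_Diff_if)
    have fy: "f y = - f x" using sum A by (simp add: eq_neg_iff_add_eq_0 add.commute)
    have "\<not> linked (f x) (f y)"
    proof
      assume "linked (f x) (f y)"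
      then have "f x = 0" using fy unfolding linked_def by (elim disjE; algebra)
      then show False using nz A by simp
    qed
    then have "?D \<le> 0" using D doubling_weight_sym nz A by simp
    moreover have "?O = 2" using A fy by (simp add: insert_Diff_if)
    ultimately show ?thesis using 3 by simp
  next
    case 4
    then obtain x y z where A: "A = {x, y, z}" "x \<noteq> y" "x \<noteq> z" "y \<noteq> z" by (auto simp: card_3_iff)
    have "?D = (doubling_weight (f x) (f y) + doubling_weight (f y) (f x))
        + (doubling_weight (f x) (f z) + doubling_weight (f z) (f x))
        + (doubling_weight (f y) (f z) + doubling_weight (f z) (f y))"
      using A by (simp add: insert_Diff_if)
    also have "\<dots> \<le> 0"
      using doubling_weight_triple[of "f x" "f y" "f z"] nz sum A
      by (simp add: doubling_weight_sym add.assoc)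
    finally show ?thesis using O 4 by simp
  next
    case 5
    then have "card A = Suc 3" by simp
    then obtain x B where B: "A = insert x B" "x \<notin> B" "card B = 3"
      by (metis card_Suc_eq)
    then obtain y z t where A: "A = {x, y, z, t}" "x \<noteq> y" "x \<noteq> z" "x \<noteq> t" "y \<noteq> z" "y \<noteq> t" "z \<noteq> t"
      by (auto simp: card_3_iff)
    have "?D = (doubling_weight (f x) (f y) + doubling_weight (f y) (f x))
        + (doubling_weight (f x) (f z) + doubling_weight (f z) (f x))
        + (doubling_weight (f x) (f t) + doubling_weight (f t) (f x))
        + (doubling_weight (f y) (f z) + doubling_weight (f z) (f y))
        + (doubling_weight (f y) (f t) + doubling_weight (f t) (f y))
        + (doubling_weight (f z) (f t) + doubling_weight (f t) (f z))"
      using A by (simp add: insert_Diff_if)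
    also have "\<dots> \<le> 2"
      using doubling_weight_quadruple[of "f x" "f y" "f z" "f t"] nz sum A
      by (simp add: doubling_weight_sym add.assoc)
    finally show ?thesis using O 5 by simp
  next
    case 6
    have "2 * ?D \<le> 2 * ?s"
      using sum_doubling_weight[OF fin nz char(1,2)]
        sum_nonneg[of UNIV "\<lambda>v. (int (card {x \<in> A. f x = v}) - int (card {x \<in> A. f x = - 2 * v}))\<^sup>2"]
      by simp
    also have "2 * ?s \<le> ?s * (?s - 3)" using 6 mult_left_mono[of 2 "?s - 3" ?s] by (simp add: mult.commute)
    finally show ?thesis using O by simp
  qed
qed

end

text \<open>For \<open>p = 7\<close> the bound on lines is needed with a factor 4 instead of 2. Lines with at least
  seven support points satisfy it trivially, the others are enumerated; the arguments count
  the symbols 1 to 6.\<close>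

lemma seven_table:
  "list_all (\<lambda>a. list_all (\<lambda>b. list_all (\<lambda>d. list_all (\<lambda>e. list_all (\<lambda>f. list_all (\<lambda>g.
    (a + 2*b + 3*d + 4*e + 5*f + 6*g) mod 7 = 0 \<longrightarrow>
     0 \<le> (a+b+d+e+f+g) * (a+b+d+e+f+g - 7) + 2 * (a*g + b*f + d*e)
       + 2 * ((a-f)*(a-f) + (b-d)*(b-d) + (d-a)*(d-a) + (e-g)*(e-g) + (f-e)*(f-e) + (g-b)*(g-b)))
    [0..6-a-b-d-e-f]) [0..6-a-b-d-e]) [0..6-a-b-d]) [0..6-a-b]) [0..6-a]) [0..6::int]"
  by code_simp

lemma seven_bound:
  fixes a b d e f g :: int
  assumes "a \<ge> 0" "b \<ge> 0" "d \<ge> 0" "e \<ge> 0" "f \<ge> 0" "g \<ge> 0"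
    and "7 dvd a + 2*b + 3*d + 4*e + 5*f + 6*g"
  shows "0 \<le> (a+b+d+e+f+g) * (a+b+d+e+f+g - 7) + 2 * (a*g + b*f + d*e)
    + 2 * ((a-f)*(a-f) + (b-d)*(b-d) + (d-a)*(d-a) + (e-g)*(e-g) + (f-e)*(f-e) + (g-b)*(g-b))"
proof (cases "a+b+d+e+f+g \<le> 6")
  case True
  then show ?thesis using seven_table assms by (simp add: list_all_iff dvd_eq_mod_eq_0)
next
  case False
  then have "0 \<le> (a+b+d+e+f+g) * (a+b+d+e+f+g - 7)" using assms by (intro mult_nonneg_nonneg) auto
  moreover have "0 \<le> a*g + b*f + d*e" using assms by simp
  ultimately show ?thesis by simp
qed

text \<open>In terms of symbol counts, \<open>sum_doubling_weight\<close> and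
  \<open>sum_opposite_pairs\<close> turn the claim into the inequality of
  \<open>seven_bound\<close>; the zero sum of the symbols is its divisibility hypothesis.\<close>

lemma doubling_weight_line_seven:
  fixes f :: "'a \<Rightarrow> 'f::field"
  assumes card: "CARD('f) = 7" and fin: "finite A" and nz: "\<And>x. x \<in> A \<Longrightarrow> f x \<noteq> 0"
    and sum: "(\<Sum>x\<in>A. f x) = 0"
  shows "4 * (\<Sum>x\<in>A. \<Sum>y\<in>A - {x}. doubling_weight (f x) (f y))
    \<le> int (card A) * (int (card A) - 3) + (\<Sum>x\<in>A. \<Sum>y\<in>A - {x}. of_bool (f y = - f x))"
proof -
  have prime: "prime (7 :: nat)" by simp
  note finF = finite_field[OF prime card]
  note char = numeral_field_neq_0[OF prime card]
  have seven: "(7 :: 'f) = 0" using of_nat_field_eq_0_iff[OF prime card, of 7] by simp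
  have "(14 :: 'f) = 2 * 7" by simp
  then have fourteen: "(14 :: 'f) = 0" by (simp only: seven mult_zero_right)
  have S: "(\<Sum>v\<in>UNIV. h v) = h 0 + h 1 + h 2 + h 3 + h 4 + h 5 + h 6" for h :: "'f \<Rightarrow> 'c::comm_monoid_add"
  proof -
    have "(\<Sum>v\<in>UNIV. h v) = (\<Sum>j\<in>{..<7::nat}. h (of_nat j))"
      unfolding of_nat_image_field[OF prime card, symmetric]
      by (simp add: sum.reindex inj_on_of_nat_field[OF prime card])
    also have "{..<7::nat} = {0, 1, 2, 3, 4, 5, 6}" by auto
    finally show ?thesis by (simp add: add.assoc)
  qed
  define N where "N v = card {x \<in> A. f x = v}" for v
  have "{x \<in> A. f x = 0} = {}" using nz by auto
  then have N0: "N 0 = 0" by (simp only: N_def card.empty)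
  have neg: "- 2 * 1 = (5 :: 'f)" "- 2 * 2 = (3 :: 'f)" "- 2 * 3 = (1 :: 'f)"
    "- 2 * 4 = (6 :: 'f)" "- 2 * 5 = (4 :: 'f)" "- 2 * 6 = (2 :: 'f)"
    using seven fourteen by (simp_all add: neg_eq_iff_add_eq_0)
  have neg1: "- 1 = (6 :: 'f)" "- 2 = (5 :: 'f)" "- 3 = (4 :: 'f)" "- 4 = (3 :: 'f)" "- 5 = (2 :: 'f)" "- 6 = (1 :: 'f)"
    using seven fourteen by (simp_all add: neg_eq_iff_add_eq_0)
  have card_A: "int (card A) = int (N 1) + int (N 2) + int (N 3) + int (N 4) + int (N 5) + int (N 6)"
    using sum_by_value[OF fin finF, of "\<lambda>_. 1 :: int" f] N0 by (simp add: S N_def)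
  have "of_nat (N 1 + 2 * N 2 + 3 * N 3 + 4 * N 4 + 5 * N 5 + 6 * N 6) = (0 :: 'f)"
    using sum_by_value[OF fin finF, of "\<lambda>v. v" f] sum by (simp add: S N_def mult.commute)
  then have "7 dvd N 1 + 2 * N 2 + 3 * N 3 + 4 * N 4 + 5 * N 5 + 6 * N 6"
    by (simp only: of_nat_field_eq_0_iff[OF prime card])
  then have "int 7 dvd int (N 1 + 2 * N 2 + 3 * N 3 + 4 * N 4 + 5 * N 5 + 6 * N 6)"
    by (simp only: of_nat_dvd_iff)
  then have dvd: "7 dvd int (N 1) + 2 * int (N 2) + 3 * int (N 3) + 4 * int (N 4) + 5 * int (N 5) + 6 * int (N 6)"
    by simp
  have D: "2 * (\<Sum>x\<in>A. \<Sum>y\<in>A - {x}. doubling_weight (f x) (f y))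
    = 2 * int (card A) - (\<Sum>v\<in>UNIV. (int (N v) - int (N (- 2 * v)))\<^sup>2)"
    unfolding N_def using sum_doubling_weight[OF fin finF nz] char by simp
  have O: "(\<Sum>x\<in>A. \<Sum>y\<in>A - {x}. of_bool (f y = - f x)) = (\<Sum>v\<in>UNIV. int (N v) * int (N (- v)))"
    unfolding N_def using sum_opposite_pairs[OF fin finF nz] char by simp
  have SD: "(\<Sum>v\<in>UNIV. (int (N v) - int (N (- 2 * v)))\<^sup>2) = (int (N 1) - int (N 5))\<^sup>2
     + (int (N 2) - int (N 3))\<^sup>2 + (int (N 3) - int (N 1))\<^sup>2 + (int (N 4) - int (N 6))\<^sup>2
     + (int (N 5) - int (N 4))\<^sup>2 + (int (N 6) - int (N 2))\<^sup>2"
    unfolding S neg using N0 by simp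
  have SO: "(\<Sum>v\<in>UNIV. int (N v) * int (N (- v)))
      = 2 * (int (N 1) * int (N 6) + int (N 2) * int (N 5) + int (N 3) * int (N 4))"
    unfolding S neg1 using N0 by simp
  have "0 \<le> int (card A) * (int (card A) - 7) + (\<Sum>v\<in>UNIV. int (N v) * int (N (- v)))
      + 2 * (\<Sum>v\<in>UNIV. (int (N v) - int (N (- 2 * v)))\<^sup>2)"
    using seven_bound[OF _ _ _ _ _ _ dvd] unfolding SD SO card_A unfolding power2_eq_square by simp
  then show ?thesis using D O by (simp add: algebra_simps)
qed

section \<open>Words with more than two symbols\<close>

locale many_symbol_word = short_dual_word points lines p c
  for points :: "'a set" and lines :: "'a set set" and p :: nat and c :: "'a \<Rightarrow> 'f::field" +
  assumes many_symbols: "card (nonzero_symbols points c) > 2"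
begin

section \<open>All non-zero symbols occur\<close>

lemma freq_double_pos:
  assumes a: "a \<noteq> 0" "freq a > 0"
  shows "freq (2 * a) > 0"
proof -
  have "\<not> nonzero_symbols points c \<subseteq> {a, - a}"
  proof
    assume "nonzero_symbols points c \<subseteq> {a, - a}"
    then have "card (nonzero_symbols points c) \<le> card {a, - a}" by (rule card_mono[rotated]) simp
    also have "\<dots> \<le> 2" by (simp add: card_insert_if)
    finally show False using many_symbols by simp
  qed
  then obtain x where x: "x \<noteq> 0" "freq x > 0" "x \<noteq> a" "x \<noteq> - a"
    by (auto simp: nonzero_symbols_def freq_pos_iff)
  obtain T where T: "2 \<le> T" "2 * T < p" "x = of_nat T * a \<or> x = - (of_nat T * a)"
    using multiple_cases[OF a(1) x(1) x(3,4)] by blast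
  have "freq (of_nat T * a) > 0" using T(3) x freq_uminus_pos[of x] by auto
  \<comment> \<open>Descent from T a reaches 2 a, because T >= 2.\<close>
  then show ?thesis using freq_smaller_multiples[OF a T(2) _ _ T(1)] by simp
qed

lemma freq_pos:
  assumes "x \<noteq> 0"
  shows "freq x > 0"
proof -
  define X where "X = {x. x \<noteq> 0 \<and> freq x > 0}"
  have "card (nonzero_symbols points c) \<noteq> 0" using many_symbols by simp
  then have "nonzero_symbols points c \<noteq> {}" by force
  then obtain a where a: "a \<noteq> 0" "freq a > 0" by (auto simp: nonzero_symbols_def freq_pos_iff)
  have "(\<lambda>x. 2 * x) ` X = X"
  proof (rule endo_inj_surj)
    show "finite X" by (rule finite_subset[OF subset_UNIV finite_F])
    show "(\<lambda>x. 2 * x) ` X \<subseteq> X" using freq_double_pos numeral_F by (auto simp: X_def)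
    show "inj_on (\<lambda>x. 2 * x) X" using numeral_F by (auto intro: inj_onI)
  qed
  moreover have "a \<in> X" using a by (simp add: X_def)
  \<comment> \<open>Doubling is an injection of a finite set into itself, hence onto, so a can be
    halved within the occurring symbols.\<close>
  ultimately obtain b where b: "b \<in> X" "a = 2 * b" by blast
  define h where "h = (p - 1) div 2"
  have "odd p" using prime_p p_ge by (auto simp: prime_odd_nat)
  then have h: "2 * h + 1 = p" by (auto simp: h_def elim: oddE)
  have "of_nat (2 * h + 1) = (0 :: 'f)" using h of_nat_0_iff_F[of p] by simp
  moreover have "of_nat h * a + b = of_nat (2 * h + 1) * b" using b(2) by (simp add: algebra_simps)
  ultimately have "of_nat h * a + b = 0" by (simp only: mult_zero_left)
  then have "of_nat h * a = - b" by (simp add: eq_neg_iff_add_eq_0)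
  then have "freq (of_nat h * a) > 0" using freq_uminus_pos[of b] b by (simp add: X_def)
  \<comment> \<open>h is the largest integer below p/2, so the descent starting there covers every
    multiple in the lower half; signs supply the rest.\<close>
  then have small: "freq (of_nat i * a) > 0" if "1 \<le> i" "2 * i < p" for i
    using freq_smaller_multiples[OF a, of h i] that h by auto
  show ?thesis
  proof (cases "x = a \<or> x = - a")
    case True
    then show ?thesis using a freq_uminus_pos by auto
  next
    case False
    then obtain T where "2 \<le> T" "2 * T < p" "x = of_nat T * a \<or> x = - (of_nat T * a)"
      using multiple_cases[of a x] a assms by blast
    then show ?thesis using small[of T] assms freq_uminus_pos[of "of_nat T * a"] by auto
  qed
qed

section \<open>Surplus over the minimal frequency, and the count of pairs\<close>

definition surplus :: "'f \<Rightarrow> int"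
  where "surplus x = freq x - (2 * int p + 1 - slack)"

lemma surplus_nonneg: "x \<noteq> 0 \<Longrightarrow> surplus x \<ge> 0"
  using freq_ge freq_pos by (simp add: surplus_def)

lemma card_nonzero: "int (card (- {0 :: 'f})) = int p - 1"
  using finite_F card_field p_ge by (simp add: Compl_eq_Diff_UNIV card_Diff_singleton of_nat_diff)

lemma sum_freq: "(\<Sum>v\<in>- {0}. freq v) = int (weight points c)"
proof -
  have "int (weight points c) = (\<Sum>v\<in>UNIV. freq v * (if v \<noteq> 0 then 1 else 0))"
    unfolding weight_eq_sum using sum_by_symbol[of "\<lambda>v. if v \<noteq> 0 then 1 else 0"] by simp
  also have "\<dots> = (\<Sum>v\<in>- {0}. freq v)"
    using finite_F by (intro sum.mono_neutral_cong_right) auto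
  finally show ?thesis by simp
qed

lemma weight_eq_slack: "int (weight points c) = 2 * int p ^ 2 - 2 * int p + 2 + slack"
  by (simp add: slack_def)

lemma sum_surplus: "(\<Sum>v\<in>- {0}. surplus v) = slack * int p + 3 - int p"
proof -
  have "(\<Sum>v\<in>- {0}. surplus v) = int (weight points c) - (int p - 1) * (2 * int p + 1 - slack)"
    unfolding surplus_def sum_subtractf sum_freq by (simp add: card_nonzero algebra_simps)
  then show ?thesis by (simp add: weight_eq_slack algebra_simps power2_eq_square)
qed

lemma sum_uminus_nonzero: "(\<Sum>v\<in>- {0}. g (- v)) = (\<Sum>v\<in>- {0 :: 'f}. (g v :: int))"
  by (rule sum.reindex_bij_witness[of _ uminus uminus]) auto

lemma sum_double_nonzero: "(\<Sum>v\<in>- {0}. g (- 2 * v)) = (\<Sum>v\<in>- {0 :: 'f}. (g v :: int))"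
  using numeral_F by (intro sum.reindex_bij_witness[of _ "\<lambda>v. - v / 2" "\<lambda>v. - 2 * v"]) auto

text \<open>Sum of the line bound over all lines, with s(s - 3) = s(s - 1) - 2s: every pair of
  support points lies on one line and every support point on p^2 + 1 lines. The factor
  \<open>\<alpha>\<close> allows for the sharper line bound at p = 7.\<close>

lemma global_inequality:
  assumes line: "\<And>A. finite A \<Longrightarrow> (\<And>x. x \<in> A \<Longrightarrow> c x \<noteq> 0) \<Longrightarrow> (\<Sum>x\<in>A. c x) = 0 \<Longrightarrow>
    2 * \<alpha> * (\<Sum>x\<in>A. \<Sum>y\<in>A - {x}. doubling_weight (c x) (c y))
    \<le> int (card A) * (int (card A) - 3) + (\<Sum>x\<in>A. \<Sum>y\<in>A - {x}. of_bool (c y = - c x))"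
  shows "\<alpha> * (2 * int (weight points c) - (\<Sum>v\<in>- {0}. (surplus v - surplus (- 2 * v))\<^sup>2))
    \<le> int (weight points c) * (int (weight points c) - 2 * int p ^ 2 - 3)
      + (\<Sum>v\<in>- {0}. freq v * freq (- v))"
proof -
  define S where "S = {x \<in> points. c x \<noteq> 0}"
  have S: "S \<subseteq> points" "finite S" "\<And>x. x \<in> S \<Longrightarrow> c x \<noteq> 0" using finite_points by (auto simp: S_def)
  have w: "weight points c = card S" by (simp add: weight_def S_def)
  have N: "int (card {x \<in> S. c x = v}) = (if v = 0 then 0 else freq v)" for v
    by (auto simp: S_def freq_def intro!: arg_cong[of _ _ card])
  have "2 * \<alpha> * (\<Sum>x\<in>l \<inter> S. \<Sum>y\<in>l \<inter> S - {x}. doubling_weight (c x) (c y))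
      \<le> (\<Sum>x\<in>l \<inter> S. \<Sum>y\<in>l \<inter> S - {x}. 1) - 2 * (\<Sum>x\<in>l \<inter> S. 1)
        + (\<Sum>x\<in>l \<inter> S. \<Sum>y\<in>l \<inter> S - {x}. of_bool (c y = - c x))" if l: "l \<in> lines" for l
  proof -
    have fin: "finite (l \<inter> S)" using S by simp
    have "(\<Sum>x\<in>l \<inter> S. c x) = (\<Sum>x\<in>l. c x)"
      using finite_line[OF l] line_subset[OF l] by (intro sum.mono_neutral_left) (auto simp: S_def)
    then have "(\<Sum>x\<in>l \<inter> S. c x) = 0" using line_sum[OF l] by simp
    note le = line[OF fin _ this]
    have "(\<Sum>x\<in>l \<inter> S. \<Sum>y\<in>l \<inter> S - {x}. 1) - 2 * (\<Sum>x\<in>l \<inter> S. 1)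
        = int (card (l \<inter> S)) * (int (card (l \<inter> S)) - 3)"
      unfolding sum_pairs_1[OF fin] by (simp add: algebra_simps)
    then show ?thesis using le S(3) by auto
  qed
  then have "(\<Sum>l\<in>lines. 2 * \<alpha> * (\<Sum>x\<in>l \<inter> S. \<Sum>y\<in>l \<inter> S - {x}. doubling_weight (c x) (c y)))
      \<le> (\<Sum>l\<in>lines. (\<Sum>x\<in>l \<inter> S. \<Sum>y\<in>l \<inter> S - {x}. 1) - 2 * (\<Sum>x\<in>l \<inter> S. 1)
        + (\<Sum>x\<in>l \<inter> S. \<Sum>y\<in>l \<inter> S - {x}. of_bool (c y = - c x)))"
    by (rule sum_mono)
  then have ineq: "2 * \<alpha> * (\<Sum>x\<in>S. \<Sum>y\<in>S - {x}. doubling_weight (c x) (c y))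
      \<le> (\<Sum>x\<in>S. \<Sum>y\<in>S - {x}. 1) - 2 * (\<Sum>l\<in>lines. \<Sum>x\<in>l \<inter> S. 1)
        + (\<Sum>x\<in>S. \<Sum>y\<in>S - {x}. of_bool (c y = - c x))"
    unfolding sum.distrib sum_subtractf sum_distrib_left[symmetric] sum_collinear_pairs_in[OF S(1)] .
  have flags: "(\<Sum>l\<in>lines. \<Sum>x\<in>l \<inter> S. 1) = int (p\<^sup>2 + 1) * int (card S)"
  proof -
    have "(\<Sum>l\<in>lines. \<Sum>x\<in>l \<inter> S. 1) = (\<Sum>l\<in>lines. \<Sum>x\<in>l. if x \<in> S then 1 else (0::int))"
      by (rule sum.cong[OF refl]) (simp add: sum.If_cases finite_line)
    also have "\<dots> = int (p\<^sup>2 + 1) * (\<Sum>x\<in>points. if x \<in> S then 1 else 0)"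
      by (simp add: sum_flags)
    also have "(\<Sum>x\<in>points. if x \<in> S then 1 else 0) = int (card S)"
      using finite_points S by (simp add: sum.If_cases Int_absorb1)
    finally show ?thesis .
  qed
  have D: "2 * (\<Sum>x\<in>S. \<Sum>y\<in>S - {x}. doubling_weight (c x) (c y))
      = 2 * int (card S) - (\<Sum>v\<in>- {0}. (surplus v - surplus (- 2 * v))\<^sup>2)"
  proof -
    have "2 * (\<Sum>x\<in>S. \<Sum>y\<in>S - {x}. doubling_weight (c x) (c y)) = 2 * int (card S)
       - (\<Sum>v\<in>UNIV. ((if v = 0 then 0 else freq v) - (if - 2 * v = 0 then 0 else freq (- 2 * v)))\<^sup>2)"
      using sum_doubling_weight[where f = c, OF S(2) finite_F S(3) numeral_F(1,2)] unfolding N .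
    \<comment> \<open>Frequencies and surpluses of non-zero symbols differ by a constant, which
      cancels in the differences.\<close>
    also have "(\<Sum>v\<in>UNIV. ((if v = 0 then 0 else freq v) - (if - 2 * v = 0 then 0 else freq (- 2 * v)))\<^sup>2)
       = (\<Sum>v\<in>- {0}. (surplus v - surplus (- 2 * v))\<^sup>2)"
      using finite_F numeral_F by (intro sum.mono_neutral_cong_right) (auto simp: surplus_def)
    finally show ?thesis .
  qed
  have O: "(\<Sum>x\<in>S. \<Sum>y\<in>S - {x}. of_bool (c y = - c x)) = (\<Sum>v\<in>- {0}. freq v * freq (- v))"
  proof -
    have "(\<Sum>x\<in>S. \<Sum>y\<in>S - {x}. of_bool (c y = - c x))
        = (\<Sum>v\<in>UNIV. (if v = 0 then 0 else freq v) * (if - v = 0 then 0 else freq (- v)))"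
      using sum_opposite_pairs[where f = c, OF S(2) finite_F S(3) numeral_F(1)] unfolding N .
    also have "\<dots> = (\<Sum>v\<in>- {0}. freq v * freq (- v))"
      using finite_F by (intro sum.mono_neutral_cong_right) auto
    finally show ?thesis .
  qed
  have "2 * \<alpha> * (\<Sum>x\<in>S. \<Sum>y\<in>S - {x}. doubling_weight (c x) (c y))
      = \<alpha> * (2 * int (card S) - (\<Sum>v\<in>- {0}. (surplus v - surplus (- 2 * v))\<^sup>2))"
    unfolding D[symmetric] by simp
  then show ?thesis using ineq unfolding flags sum_pairs_1[OF S(2)] O w by (simp add: algebra_simps)
qed

section \<open>Quadratic estimates and the contradiction\<close>

definition class_surplus :: "'f \<Rightarrow> int"
  where "class_surplus x = surplus x + surplus (- x)"

text \<open>With \<open>\<mu>\<close> the minimal class surplus, \<open>class_freq_le\<close> puts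
  every class surplus s into [\<open>\<mu>\<close>, \<open>\<mu>\<close> + 4], so (s -
  \<open>\<mu>\<close>)(\<open>\<mu>\<close> + 4 - s) >= 0. This bounds s^2 by a linear function of
  s, whose sum is known.\<close>

lemma class_surplus_bound:
  "\<exists>\<mu>\<ge>0. (\<Sum>v\<in>- {0}. (class_surplus v)\<^sup>2)
     \<le> (2 * \<mu> + 4) * (2 * (slack * int p + 3 - int p)) - (int p - 1) * (\<mu>\<^sup>2 + 4 * \<mu>)"
proof -
  have fin: "finite (- {0 :: 'f})" by (rule finite_subset[OF subset_UNIV finite_F])
  have "1 \<in> - {0 :: 'f}" by simp
  then have ne: "- {0 :: 'f} \<noteq> {}" by blast
  obtain a where a: "a \<noteq> 0" "\<And>x. x \<noteq> 0 \<Longrightarrow> class_surplus a \<le> class_surplus x"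
    using arg_min_if_finite[OF fin ne, of class_surplus] by (auto simp: not_less)
  define \<mu> where "\<mu> = class_surplus a"
  have "\<mu> \<ge> 0" using surplus_nonneg[of a] surplus_nonneg[of "- a"] a by (simp add: \<mu>_def class_surplus_def)
  have "(class_surplus v)\<^sup>2 \<le> (2 * \<mu> + 4) * class_surplus v - (\<mu>\<^sup>2 + 4 * \<mu>)" if v: "v \<noteq> 0" for v
  proof -
    have "class_surplus v \<le> \<mu> + 4"
      using class_freq_le[of a v] freq_pos[of a] a v
      by (simp add: class_surplus_def \<mu>_def surplus_def class_freq_def)
    then have "(class_surplus v - \<mu>) * (\<mu> + 4 - class_surplus v) \<ge> 0"
      using a(2)[OF v] by (intro mult_nonneg_nonneg) (auto simp: \<mu>_def)
    then show ?thesis by (simp add: algebra_simps power2_eq_square)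
  qed
  then have "(\<Sum>v\<in>- {0}. (class_surplus v)\<^sup>2)
      \<le> (\<Sum>v\<in>- {0}. (2 * \<mu> + 4) * class_surplus v - (\<mu>\<^sup>2 + 4 * \<mu>))"
    by (intro sum_mono) auto
  also have "\<dots> = (2 * \<mu> + 4) * (\<Sum>v\<in>- {0}. class_surplus v) - (int p - 1) * (\<mu>\<^sup>2 + 4 * \<mu>)"
    by (simp add: sum_subtractf sum_distrib_left card_nonzero)
  also have "(\<Sum>v\<in>- {0}. class_surplus v) = 2 * (slack * int p + 3 - int p)"
    using sum_uminus_nonzero[of surplus] by (simp add: class_surplus_def sum.distrib sum_surplus)
  finally show ?thesis using \<open>\<mu> \<ge> 0\<close> by blast
qed

lemma surplus_quadratic_bound:
  assumes \<alpha>: "\<alpha> \<ge> 1"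
  shows "(\<Sum>v\<in>- {0}. surplus v * surplus (- v)) + \<alpha> * (\<Sum>v\<in>- {0}. (surplus v - surplus (- 2 * v))\<^sup>2)
    \<le> \<alpha> * (\<Sum>v\<in>- {0}. (class_surplus v)\<^sup>2)"
proof -
  have "(\<Sum>v\<in>- {0}. (surplus v - surplus (- 2 * v))\<^sup>2) \<le> (\<Sum>v\<in>- {0}. (surplus v)\<^sup>2 + (surplus (- 2 * v))\<^sup>2)"
  proof (rule sum_mono)
    fix v :: 'f assume v: "v \<in> - {0}"
    then have "surplus v * surplus (- 2 * v) \<ge> 0"
      using surplus_nonneg[of v] surplus_nonneg[of "- 2 * v"] numeral_F by simp
    then show "(surplus v - surplus (- 2 * v))\<^sup>2 \<le> (surplus v)\<^sup>2 + (surplus (- 2 * v))\<^sup>2"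
      by (simp add: power2_diff)
  qed
  also have "\<dots> = (\<Sum>v\<in>- {0}. (surplus v)\<^sup>2 + (surplus (- v))\<^sup>2)"
    using sum_double_nonzero[of "\<lambda>v. (surplus v)\<^sup>2"] sum_uminus_nonzero[of "\<lambda>v. (surplus v)\<^sup>2"]
    by (simp add: sum.distrib)
  finally have 1: "\<alpha> * (\<Sum>v\<in>- {0}. (surplus v - surplus (- 2 * v))\<^sup>2)
      \<le> \<alpha> * (\<Sum>v\<in>- {0}. (surplus v)\<^sup>2 + (surplus (- v))\<^sup>2)"
    using \<alpha> by (intro mult_left_mono) auto
  have "0 \<le> (\<Sum>v\<in>- {0}. surplus v * surplus (- v))"
    using surplus_nonneg by (intro sum_nonneg) auto
  then have "(\<Sum>v\<in>- {0}. surplus v * surplus (- v)) \<le> \<alpha> * (2 * (\<Sum>v\<in>- {0}. surplus v * surplus (- v)))"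
    using \<alpha> mult_right_mono[of 1 "2 * \<alpha>" "\<Sum>v\<in>- {0}. surplus v * surplus (- v)"] by simp
  also have "\<dots> = \<alpha> * (\<Sum>v\<in>- {0}. 2 * (surplus v * surplus (- v)))" by (simp add: sum_distrib_left)
  finally have "(\<Sum>v\<in>- {0}. surplus v * surplus (- v)) + \<alpha> * (\<Sum>v\<in>- {0}. (surplus v - surplus (- 2 * v))\<^sup>2)
      \<le> \<alpha> * (\<Sum>v\<in>- {0}. 2 * (surplus v * surplus (- v)))
        + \<alpha> * (\<Sum>v\<in>- {0}. (surplus v)\<^sup>2 + (surplus (- v))\<^sup>2)"
    using 1 by simp
  also have "\<dots> = \<alpha> * (\<Sum>v\<in>- {0}. (class_surplus v)\<^sup>2)"
    by (simp add: class_surplus_def power2_sum sum.distrib algebra_simps sum_distrib_left)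
  finally show ?thesis .
qed

lemma sum_freq_opposite:
  fixes r :: int
  defines "r \<equiv> 2 * int p + 1 - slack"
  shows "(\<Sum>v\<in>- {0}. freq v * freq (- v)) = (int p - 1) * r\<^sup>2
    + 2 * r * (slack * int p + 3 - int p) + (\<Sum>v\<in>- {0}. surplus v * surplus (- v))"
proof -
  have "freq v * freq (- v) = r\<^sup>2 + r * surplus v + r * surplus (- v) + surplus v * surplus (- v)" for v
    by (simp add: surplus_def r_def algebra_simps power2_eq_square)
  then have "(\<Sum>v\<in>- {0}. freq v * freq (- v)) = (int p - 1) * r\<^sup>2 + r * (\<Sum>v\<in>- {0}. surplus v)
     + r * (\<Sum>v\<in>- {0}. surplus (- v)) + (\<Sum>v\<in>- {0}. surplus v * surplus (- v))"
    by (simp add: sum.distrib card_nonzero sum_distrib_left)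
  then show ?thesis
    using sum_uminus_nonzero[of surplus] by (simp add: sum_surplus)
qed

lemma many_symbol_word_impossible: False
proof -
  define q where "q = int p"
  have q: "q \<ge> 7" using p_ge by (simp add: q_def)
  obtain \<mu> where \<mu>: "\<mu> \<ge> 0" "(\<Sum>v\<in>- {0}. (class_surplus v)\<^sup>2)
     \<le> (2 * \<mu> + 4) * (2 * (slack * q + 3 - q)) - (q - 1) * (\<mu>\<^sup>2 + 4 * \<mu>)"
    using class_surplus_bound unfolding q_def by blast
  \<comment> \<open>The quadratic sums over symbols are eliminated; only q, \<open>slack\<close>,
    \<open>\<mu>\<close> and \<open>\<alpha>\<close> remain.\<close>
  have main: "\<alpha> * (2 * (2 * q^2 - 2 * q + 2 + slack))
    \<le> (2 * q^2 - 2 * q + 2 + slack) * (slack - 2 * q - 1)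
      + (q - 1) * (2 * q + 1 - slack)\<^sup>2 + 2 * (2 * q + 1 - slack) * (slack * q + 3 - q)
      + \<alpha> * ((2 * \<mu> + 4) * (2 * (slack * q + 3 - q)) - (q - 1) * (\<mu>\<^sup>2 + 4 * \<mu>))"
    if "\<alpha> = 1 \<or> \<alpha> = 2 \<and> p = 7" for \<alpha> :: int
  proof -
    have g1: "\<alpha> * (2 * int (weight points c) - (\<Sum>v\<in>- {0}. (surplus v - surplus (- 2 * v))\<^sup>2))
      \<le> int (weight points c) * (int (weight points c) - 2 * int p ^ 2 - 3)
        + (\<Sum>v\<in>- {0}. freq v * freq (- v))"
    proof (rule global_inequality)
      fix A assume A: "finite A" "\<And>x. x \<in> A \<Longrightarrow> c x \<noteq> 0" "(\<Sum>x\<in>A. c x) = 0"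
      show "2 * \<alpha> * (\<Sum>x\<in>A. \<Sum>y\<in>A - {x}. doubling_weight (c x) (c y))
        \<le> int (card A) * (int (card A) - 3) + (\<Sum>x\<in>A. \<Sum>y\<in>A - {x}. of_bool (c y = - c x))"
        using that
      proof
        assume "\<alpha> = 1"
        then show ?thesis using doubling_weight_line[OF numeral_F A(1) finite_F A(2,3)] by simp
      next
        assume "\<alpha> = 2 \<and> p = 7"
        then show ?thesis using doubling_weight_line_seven[OF _ A] card_field by simp
      qed
    qed
    have W: "int (weight points c) = 2 * q^2 - 2 * q + 2 + slack"
      "int (weight points c) - 2 * int p ^ 2 - 3 = slack - 2 * q - 1"
      by (simp_all add: weight_eq_slack q_def)
    note g1 = g1[unfolded W(2) sum_freq_opposite right_diff_distrib[of \<alpha> "2 * int (weight points c)"],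
      unfolded W(1), folded q_def]
    have g2: "(\<Sum>v\<in>- {0}. surplus v * surplus (- v))
        + \<alpha> * (\<Sum>v\<in>- {0}. (surplus v - surplus (- 2 * v))\<^sup>2)
      \<le> \<alpha> * (\<Sum>v\<in>- {0}. (class_surplus v)\<^sup>2)"
      using that by (intro surplus_quadratic_bound) auto
    have g3: "\<alpha> * (\<Sum>v\<in>- {0}. (class_surplus v)\<^sup>2)
      \<le> \<alpha> * ((2 * \<mu> + 4) * (2 * (slack * q + 3 - q)) - (q - 1) * (\<mu>\<^sup>2 + 4 * \<mu>))"
      using that \<mu>(2) by (intro mult_left_mono) auto
    have combine: "x \<le> z + r + r' + u" if "x - y \<le> z + (r + r' + s)" "s + y \<le> t" "t \<le> u"
      for x y z r r' s t u :: int
      using that by linarith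
    show ?thesis by (rule combine[OF g1 g2 g3])
  qed
  \<comment> \<open>With \<open>slack\<close> <= 0 the total surplus would be at most 3 - q <
    0.\<close>
  have "0 \<le> (\<Sum>v\<in>- {0}. surplus v)" using surplus_nonneg by (intro sum_nonneg) auto
  then have nn: "0 \<le> slack * q + 3 - q" by (simp add: sum_surplus q_def)
  have "slack \<ge> 1"
  proof (rule ccontr)
    assume "\<not> slack \<ge> 1"
    then have "slack * q \<le> 0" using q by (simp add: mult_le_0_iff)
    then show False using nn q by simp
  qed
  then consider "slack = 1" | "slack = 2" using slack_le by linarith
  then show False
  proof cases
    case 1
    \<comment> \<open>The cubic terms cancel. For q >= 7 the left side exceeds 24, the largest
      possible value of the right side.\<close>
    have "4 * (q * q) - 10 * q + 6 \<le> 24 - 12 * \<mu> - (q - 1) * \<mu>\<^sup>2 - 4 * (q - 7) * \<mu>"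
      using main[of 1] unfolding 1 by (simp add: algebra_simps power2_eq_square)
    moreover have "(q - 1) * \<mu>\<^sup>2 \<ge> 0" "4 * (q - 7) * \<mu> \<ge> 0" using q \<mu> by simp_all
    moreover have "q * q \<ge> 7 * q" using q by (intro mult_right_mono) auto
    ultimately show False using q \<mu>(1) by linarith
  next
    case 2
    have "6 * \<mu>\<^sup>2 \<le> (q - 1) * \<mu>\<^sup>2" using q by (intro mult_right_mono) auto
    \<comment> \<open>Integrality matters: 10 is attained at \<open>\<mu>\<close> = 1, but the real
      maximum of 16 \<open>\<mu>\<close> - 6 \<open>\<mu>\<close>^2 is larger.\<close>
    moreover have "16 * \<mu> \<le> 6 * \<mu>\<^sup>2 + 10"
    proof -
      consider "\<mu> = 0" | "\<mu> = 1" | "\<mu> \<ge> 2" using \<mu>(1) by linarith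
      then show ?thesis
      proof cases
        case 3
        then have "0 \<le> (\<mu> - 1) * (\<mu> - 2)" by simp
        then show ?thesis using 3 by (simp add: algebra_simps power2_eq_square)
      qed simp_all
    qed
    ultimately have U: "16 * \<mu> - (q - 1) * \<mu>\<^sup>2 \<le> 10" by linarith
    show False
    proof (cases "p = 7")
      case True
      then have "q = 7" by (simp add: q_def)
      \<comment> \<open>For q = 7 the factor \<open>\<alpha>\<close> = 1 gives no contradiction, but
        \<open>\<alpha>\<close> = 2 gives 352 <= 130 + 2 (80 + 10) = 310.\<close>
      then show False using main[of 2] True U unfolding 2 by (simp add: algebra_simps)
    next
      case False
      have "p \<noteq> 8" "p \<noteq> 9" using prime_p by auto
      then have q10: "q \<ge> 10" using False p_ge by (simp add: q_def)
      have "2 * (q * q) - 9 * q + 11 \<le> 8 * q + 24 + (16 * \<mu> - (q - 1) * \<mu>\<^sup>2)"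
        using main[of 1] unfolding 2 by (simp add: algebra_simps power2_eq_square)
      moreover have "q * q \<ge> 10 * q" using q10 by (intro mult_right_mono) auto
      ultimately show False using U q10 by linarith
    qed
  qed
qed

end


theorem mainTheorem4:
  fixes points :: "'a set" and lines :: "'a set set" and p :: nat
  assumes "prime p" and "p \<ge> 7"
    and "CARD('f::field) = p"
    and "projective_plane_of_order points lines (p^2)"
  shows "\<not> (\<exists>c :: 'a \<Rightarrow> 'f. c \<in> dual_code points lines \<and> c \<noteq> 0
      \<and> weight points c \<le> 2 * p^2 - 2 * p + 4
      \<and> card (nonzero_symbols points c) > 2)"
proof
  assume "\<exists>c :: 'a \<Rightarrow> 'f. c \<in> dual_code points lines \<and> c \<noteq> 0
      \<and> weight points c \<le> 2 * p^2 - 2 * p + 4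
      \<and> card (nonzero_symbols points c) > 2"
  then obtain c :: "'a \<Rightarrow> 'f" where c: "c \<in> dual_code points lines"
    "weight points c \<le> 2 * p^2 - 2 * p + 4" "card (nonzero_symbols points c) > 2"
    by blast
  interpret projective_plane_of_order points lines "p^2" by (rule assms(4))
  interpret many_symbol_word points lines p c
    by unfold_locales (use assms c in \<open>auto simp: dual_code_def\<close>)
  show False by (rule many_symbol_word_impossible)
qed

end
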